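(* Let $X$ be a simplicial set. Then $X$ is a quasi-2-Segal set if and only if both of its path spaces $P^{\triangleleft}(X)$ and $P^{\triangleright}(X)$ are quasi-categories.
   Context: $\Delta[n]$ is the standard $n$-simplex and $d_\ell\Delta[n]$ is its face opposite the vertex $\ell$. For $n\geq 3$, a subset $S\subseteq\{0,\ldots,n\}$ is broken if there exist $0\leq i<j<k<\ell\leq n$ such that either $i,k\in S$ and $j,\ell\notin S$, or $i,k\notin S$ and $j,\ell\in S$. For $n\ge 3$ and a broken two-element subset $\{i,j\}\subseteq\{0,\ldots,n\}$, the 2-Segal horn $\Lambda^{i,j}[n]\subseteq\Delta[n]$ is the union of all faces $d_\ell\Delta[n]$ with $\ell\neq i,j$. A simplicial set $X$ is a quasi-2-Segal set if every map $\Lambda^{i,j}[n]\to X$ from a 2-Segal horn extends along the inclusion $\Lambda^{i,j}[n]\hookrightarrow\Delta[n]$ to a map $\Delta[n]\to X$. The path spaces of a simplicial set $X$: the left path space $P^{\triangleleft}(X)$ is the simplicial set whose $n$-simplices are the maps $\Delta[0]\star\Delta[n]\to X$, and the right path space $P^{\triangleright}(X)$ is the simplicial set whose $n$-simplices are the maps $\Delta[n]\star\Delta[0]\to X$, where $\star$ is the join of simplicial sets (so $\Delta[0]\star\Delta[n]\cong\Delta[n+1]\cong\Delta[n]\star\Delta[0]$) and the simplicial structure is induced by functoriality in $[n]$. A quasi-category is a simplicial set with fillers of all inner horn inclusions $\Lambda^i[n]\hookrightarrow\Delta[n]$, $0<i<n$. *)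

theory Defs
  imports Main "HOL-Library.FuncSet"
begin

section \<open>Simplicial sets\<close>

text \<open>Morphisms \<open>[m] \<rightarrow> [n]\<close> of the simplex category. They are extensional functions, so that
  each weakly monotone map \<open>{0,\<dots>,m} \<rightarrow> {0,\<dots>,n}\<close> has exactly one representative.\<close>

definition simplex_mor :: "nat \<Rightarrow> nat \<Rightarrow> (nat \<Rightarrow> nat) set" where
  "simplex_mor m n = {\<theta> \<in> {..m} \<rightarrow>\<^sub>E {..n}. mono_on {..m} \<theta>}"

text \<open>\<open>act X m n \<theta> : X\<^sub>n \<rightarrow> X\<^sub>m\<close> is the operator induced by \<open>\<theta> : [m] \<rightarrow> [n]\<close>. Both degrees are
  arguments because the sets \<open>X\<^sub>n\<close> may overlap and \<open>\<theta>\<close> does not determine its codomain.\<close>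

record 'a sset =
  simp_set :: "nat \<Rightarrow> 'a set"
  act :: "nat \<Rightarrow> nat \<Rightarrow> (nat \<Rightarrow> nat) \<Rightarrow> 'a \<Rightarrow> 'a"

definition simplicial_set :: "'a sset \<Rightarrow> bool" where
  "simplicial_set X \<longleftrightarrow>
     (\<forall>m n. \<forall>\<theta>\<in>simplex_mor m n. act X m n \<theta> \<in> simp_set X n \<rightarrow> simp_set X m) \<and>
     (\<forall>n. \<forall>x\<in>simp_set X n. act X n n (restrict id {..n}) x = x) \<and>
     (\<forall>k m n. \<forall>\<phi>\<in>simplex_mor k m. \<forall>\<theta>\<in>simplex_mor m n. \<forall>x\<in>simp_set X n.
        act X k n (compose {..k} \<theta> \<phi>) x = act X k m \<phi> (act X m n \<theta> x))"

text \<open>Simplicial maps, again extensional in each degree: the simplices of a path space are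
  simplicial maps, so equality of maps has to be equality of functions.\<close>

definition sset_hom :: "'a sset \<Rightarrow> 'b sset \<Rightarrow> (nat \<Rightarrow> 'a \<Rightarrow> 'b) set" where
  "sset_hom X Y =
     {f. (\<forall>n. f n \<in> simp_set X n \<rightarrow>\<^sub>E simp_set Y n) \<and>
         (\<forall>m n. \<forall>\<theta>\<in>simplex_mor m n. \<forall>x\<in>simp_set X n.
            f m (act X m n \<theta> x) = act Y m n \<theta> (f n x))}"

definition sset_id :: "'a sset \<Rightarrow> nat \<Rightarrow> 'a \<Rightarrow> 'a" where
  "sset_id X n = restrict id (simp_set X n)"

text \<open>The composite \<open>g \<circ> f\<close>, where \<open>X\<close> is the domain of \<open>f\<close>.\<close>

definition sset_comp :: "'a sset \<Rightarrow> (nat \<Rightarrow> 'b \<Rightarrow> 'c) \<Rightarrow> (nat \<Rightarrow> 'a \<Rightarrow> 'b) \<Rightarrow> nat \<Rightarrow> 'a \<Rightarrow> 'c" where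
  "sset_comp X g f n = compose (simp_set X n) (g n) (f n)"

text \<open>Used for \<open>A\<close> a simplicial subset of \<open>B\<close>: every map \<open>A \<rightarrow> X\<close> extends along \<open>A \<hookrightarrow> B\<close>.\<close>

definition extends_along :: "'b sset \<Rightarrow> 'b sset \<Rightarrow> 'a sset \<Rightarrow> bool" where
  "extends_along A B X \<longleftrightarrow>
     (\<forall>f\<in>sset_hom A X. \<exists>g\<in>sset_hom B X. \<forall>m. \<forall>x\<in>simp_set A m. g m x = f m x)"


section \<open>Standard simplices and horns\<close>

definition std_simplex :: "nat \<Rightarrow> (nat \<Rightarrow> nat) sset" where
  "std_simplex n = \<lparr>simp_set = (\<lambda>m. simplex_mor m n), act = (\<lambda>k m \<phi> \<sigma>. compose {..k} \<sigma> \<phi>)\<rparr>"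

text \<open>The map \<open>\<Delta>[m] \<rightarrow> \<Delta>[n]\<close> induced by \<open>\<theta> : [m] \<rightarrow> [n]\<close>.\<close>

definition std_map :: "nat \<Rightarrow> (nat \<Rightarrow> nat) \<Rightarrow> nat \<Rightarrow> (nat \<Rightarrow> nat) \<Rightarrow> (nat \<Rightarrow> nat)" where
  "std_map m \<theta> k = (\<lambda>\<sigma>\<in>simplex_mor k m. compose {..k} \<theta> \<sigma>)"

text \<open>The face of \<open>\<Delta>[n]\<close> opposite \<open>l\<close>: the simplices \<open>[m] \<rightarrow> [n]\<close> that factor through \<open>{0,\<dots>,n} - {l}\<close>.\<close>

definition face :: "nat \<Rightarrow> nat \<Rightarrow> (nat \<Rightarrow> nat) sset" where
  "face n l = \<lparr>simp_set = (\<lambda>m. {\<sigma> \<in> simplex_mor m n. l \<notin> \<sigma> ` {..m}}), act = act (std_simplex n)\<rparr>"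

definition face_union :: "nat \<Rightarrow> nat set \<Rightarrow> (nat \<Rightarrow> nat) sset" where
  "face_union n L = \<lparr>simp_set = (\<lambda>m. \<Union>l\<in>L. simp_set (face n l) m), act = act (std_simplex n)\<rparr>"

definition horn :: "nat \<Rightarrow> nat \<Rightarrow> (nat \<Rightarrow> nat) sset" where
  "horn n i = face_union n ({..n} - {i})"

definition segal_horn :: "nat \<Rightarrow> nat \<Rightarrow> nat \<Rightarrow> (nat \<Rightarrow> nat) sset" where
  "segal_horn n i j = face_union n ({..n} - {i, j})"

definition broken :: "nat \<Rightarrow> nat set \<Rightarrow> bool" where
  "broken n S \<longleftrightarrow>
     (\<exists>i j k l. i < j \<and> j < k \<and> k < l \<and> l \<le> n \<and>
        (i \<in> S \<and> k \<in> S \<and> j \<notin> S \<and> l \<notin> S \<or> i \<notin> S \<and> k \<notin> S \<and> j \<in> S \<and> l \<in> S))"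

definition quasi_2_segal_set :: "'a sset \<Rightarrow> bool" where
  "quasi_2_segal_set X \<longleftrightarrow> simplicial_set X \<and>
     (\<forall>n\<ge>3. \<forall>i j. {i, j} \<subseteq> {..n} \<and> i \<noteq> j \<and> broken n {i, j} \<longrightarrow>
        extends_along (segal_horn n i j) (std_simplex n) X)"

definition quasi_category :: "'a sset \<Rightarrow> bool" where
  "quasi_category X \<longleftrightarrow> simplicial_set X \<and>
     (\<forall>n i. 0 < i \<and> i < n \<longrightarrow> extends_along (horn n i) (std_simplex n) X)"


section \<open>Joins and path spaces\<close>

text \<open>The \<open>n\<close>-simplices of \<open>X \<star> Y\<close> form \<open>X\<^sub>n \<squnion> Y\<^sub>n \<squnion> \<Coprod>\<^sub>p\<^sub>+\<^sub>q\<^sub>=\<^sub>n\<^sub>-\<^sub>1 X\<^sub>p \<times> Y\<^sub>q\<close>. In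
  \<open>JoinBoth p x y\<close> the vertices \<open>0,\<dots>,p\<close> belong to \<open>x\<close> and \<open>p+1,\<dots>,n\<close> to \<open>y\<close>.\<close>

datatype ('a, 'b) join_simplex = JoinLeft 'a | JoinRight 'b | JoinBoth nat 'a 'b

text \<open>An operator \<open>\<theta> : [m] \<rightarrow> [n]\<close> acts on \<open>JoinBoth p x y\<close> by splitting \<open>[m]\<close> into the \<open>c\<close> elements
  sent to \<open>{0,\<dots>,p}\<close> (an initial segment, as \<open>\<theta>\<close> is monotone) and those sent to \<open>{p+1,\<dots>,n}\<close>.\<close>

fun join_act :: "'a sset \<Rightarrow> 'b sset \<Rightarrow> nat \<Rightarrow> nat \<Rightarrow> (nat \<Rightarrow> nat) \<Rightarrow>
    ('a, 'b) join_simplex \<Rightarrow> ('a, 'b) join_simplex" where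
  "join_act X Y m n \<theta> (JoinLeft x) = JoinLeft (act X m n \<theta> x)"
| "join_act X Y m n \<theta> (JoinRight y) = JoinRight (act Y m n \<theta> y)"
| "join_act X Y m n \<theta> (JoinBoth p x y) =
    (let c = card {k \<in> {..m}. \<theta> k \<le> p}; q = n - Suc p in
     if c = Suc m then JoinLeft (act X m p \<theta> x)
     else if c = 0 then JoinRight (act Y m q (\<lambda>k\<in>{..m}. \<theta> k - Suc p) y)
     else JoinBoth (c - 1)
       (act X (c - 1) p (restrict \<theta> {..c - 1}) x)
       (act Y (m - c) q (\<lambda>k\<in>{..m - c}. \<theta> (c + k) - Suc p) y))"

definition join :: "'a sset \<Rightarrow> 'b sset \<Rightarrow> ('a, 'b) join_simplex sset"  (infixr "\<star>" 65) where
  "X \<star> Y = \<lparr>simp_set = (\<lambda>n. JoinLeft ` simp_set X n \<union> JoinRight ` simp_set Y n \<union>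
                {JoinBoth p x y |p x y. p < n \<and> x \<in> simp_set X p \<and> y \<in> simp_set Y (n - Suc p)}),
            act = join_act X Y\<rparr>"

text \<open>The map \<open>f \<star> g : X \<star> Y \<rightarrow> X' \<star> Y'\<close>.\<close>

definition join_map :: "'a sset \<Rightarrow> 'b sset \<Rightarrow> (nat \<Rightarrow> 'a \<Rightarrow> 'c) \<Rightarrow> (nat \<Rightarrow> 'b \<Rightarrow> 'd) \<Rightarrow>
    nat \<Rightarrow> ('a, 'b) join_simplex \<Rightarrow> ('c, 'd) join_simplex" where
  "join_map X Y f g n = (\<lambda>s\<in>simp_set (X \<star> Y) n.
     case s of
       JoinLeft x \<Rightarrow> JoinLeft (f n x)
     | JoinRight y \<Rightarrow> JoinRight (g n y)
     | JoinBoth p x y \<Rightarrow> JoinBoth p (f p x) (g (n - Suc p) y))"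

definition left_path_space ::
    "'a sset \<Rightarrow> (nat \<Rightarrow> (nat \<Rightarrow> nat, nat \<Rightarrow> nat) join_simplex \<Rightarrow> 'a) sset" where
  "left_path_space X =
     \<lparr>simp_set = (\<lambda>n. sset_hom (std_simplex 0 \<star> std_simplex n) X),
      act = (\<lambda>m n \<theta> h. sset_comp (std_simplex 0 \<star> std_simplex m) h
               (join_map (std_simplex 0) (std_simplex m) (sset_id (std_simplex 0)) (std_map m \<theta>)))\<rparr>"

definition right_path_space ::
    "'a sset \<Rightarrow> (nat \<Rightarrow> (nat \<Rightarrow> nat, nat \<Rightarrow> nat) join_simplex \<Rightarrow> 'a) sset" where
  "right_path_space X =
     \<lparr>simp_set = (\<lambda>n. sset_hom (std_simplex n \<star> std_simplex 0) X),
      act = (\<lambda>m n \<theta> h. sset_comp (std_simplex m \<star> std_simplex 0) h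
               (join_map (std_simplex m) (std_simplex 0) (std_map m \<theta>) (sset_id (std_simplex 0))))\<rparr>"

end

(* An (n+1)-simplex of X is an n-simplex of either path space, and the face opposite l of the path
   space is the face opposite l + 1 (left) or l (right) of X. Hence inner horns in the left and right
   path space are the 2-Segal horns of X that miss the face opposite 0, respectively opposite the
   last vertex. A general 2-Segal horn missing the faces opposite i and j is obtained from these by
   induction on the number of vertices after j: after doubling the vertex 0, the required simplex
   appears as a face of a simplex that can be filled by horns of the special kind together with one
   horn having fewer vertices after j. *)

theory Submission imports Defs begin

section \<open>Simplicial operators\<close>

text \<open>Horn extension problems appear in two forms. Fillings are built up with families of
  vertex sets: a union of faces is determined by the vertex sets that occur in it, so attaching a
  simplex only requires knowing which of its facets are present. Path spaces are compared with X
  through compatible families of faces, where only face operators have to be matched.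

  The obstacle in the induction is circularity. Once 0 is doubled, the pullback of the horn meets
  the face opposite either copy of 0 in the original horn again. The face opposite the last vertex,
  although available in the pullback, is therefore left out at the start. On the face opposite 1 the
  missing pair can then be turned into the copy of i and the last vertex, which is a horn of the
  right path space. The omitted face is filled afterwards; in it the copies of i and j stand one
  place further right, so one vertex fewer follows j. The last horn misses the faces opposite 0 and
  opposite the copy of i, so its filler produces the wanted face opposite 0.\<close>

lemma simplex_morI:
  assumes "\<And>k. k \<le> m \<Longrightarrow> \<theta> k \<le> n" "\<And>k l. k \<le> l \<Longrightarrow> l \<le> m \<Longrightarrow> \<theta> k \<le> \<theta> l"
    "\<And>k. \<not> k \<le> m \<Longrightarrow> \<theta> k = undefined"
  shows "\<theta> \<in> simplex_mor m n"
  using assms by (auto simp: simplex_mor_def mono_on_def PiE_def extensional_def)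

lemma simplex_mor_le: "\<theta> \<in> simplex_mor m n \<Longrightarrow> k \<le> m \<Longrightarrow> \<theta> k \<le> n"
  by (auto simp: simplex_mor_def)

lemma simplex_mor_mono: "\<theta> \<in> simplex_mor m n \<Longrightarrow> k \<le> l \<Longrightarrow> l \<le> m \<Longrightarrow> \<theta> k \<le> \<theta> l"
  by (auto simp: simplex_mor_def mono_on_def)

lemma simplex_mor_undefined: "\<theta> \<in> simplex_mor m n \<Longrightarrow> \<not> k \<le> m \<Longrightarrow> \<theta> k = undefined"
  by (auto simp: simplex_mor_def PiE_def extensional_def)

lemma simplex_mor_eqI:
  assumes "\<theta> \<in> simplex_mor m n" "\<phi> \<in> simplex_mor m n'" "\<And>k. k \<le> m \<Longrightarrow> \<theta> k = \<phi> k"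
  shows "\<theta> = \<phi>"
  using assms simplex_mor_undefined by (metis ext)

lemma simplex_mor_id: "restrict id {..n} \<in> simplex_mor n n"
  by (rule simplex_morI) auto

lemma simplex_mor_compose:
  assumes "\<phi> \<in> simplex_mor k m" "\<theta> \<in> simplex_mor m n"
  shows "compose {..k} \<theta> \<phi> \<in> simplex_mor k n"
  using assms
  by (intro simplex_morI) (auto simp: compose_def simplex_mor_le intro!: simplex_mor_mono[OF assms(2)] simplex_mor_mono[OF assms(1)])

lemma compose_restrict_id: "\<theta> \<in> simplex_mor m n \<Longrightarrow> compose {..m} (restrict id {..n}) \<theta> = \<theta>"
  by (rule simplex_mor_eqI[OF simplex_mor_compose[OF _ simplex_mor_id]])
     (auto simp: compose_def simplex_mor_le)

lemma compose_simplex_mor_assoc: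
  assumes "\<phi> \<in> simplex_mor k m"
  shows "compose {..k} (compose {..m} \<theta> \<sigma>) \<phi> = compose {..k} \<theta> (compose {..k} \<sigma> \<phi>)"
  using assms by (auto simp: compose_def fun_eq_iff simplex_mor_le)

lemma image_compose_subset:
  "\<phi> \<in> simplex_mor k m \<Longrightarrow> compose {..k} \<sigma> \<phi> ` {..k} \<subseteq> \<sigma> ` {..m}"
  by (auto simp: compose_def simplex_mor_le)

lemma simplicial_act_in:
  "simplicial_set X \<Longrightarrow> \<theta> \<in> simplex_mor m n \<Longrightarrow> x \<in> simp_set X n \<Longrightarrow> act X m n \<theta> x \<in> simp_set X m"
  by (auto simp: simplicial_set_def Pi_iff)

lemma simplicial_act_id:
  "simplicial_set X \<Longrightarrow> x \<in> simp_set X n \<Longrightarrow> act X n n (restrict id {..n}) x = x"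
  by (auto simp: simplicial_set_def)

lemma simplicial_act_compose:
  "simplicial_set X \<Longrightarrow> \<phi> \<in> simplex_mor k m \<Longrightarrow> \<theta> \<in> simplex_mor m n \<Longrightarrow> x \<in> simp_set X n \<Longrightarrow>
    act X k m \<phi> (act X m n \<theta> x) = act X k n (compose {..k} \<theta> \<phi>) x"
  by (auto simp: simplicial_set_def)


section \<open>Partial simplices\<close>

text \<open>A family \<open>K\<close> of vertex sets stands for the simplicial subset of \<open>\<Delta>[N]\<close> of those simplices whose
  set of vertices belongs to \<open>K\<close>. In contrast to \<^const>\<open>sset_hom\<close> no extensionality is required.\<close>

definition partial_simplex ::
    "'a sset \<Rightarrow> nat \<Rightarrow> nat set set \<Rightarrow> (nat \<Rightarrow> (nat \<Rightarrow> nat) \<Rightarrow> 'a) \<Rightarrow> bool" where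
  "partial_simplex X N K f \<longleftrightarrow>
     (\<forall>m. \<forall>\<sigma>\<in>simplex_mor m N. \<sigma> ` {..m} \<in> K \<longrightarrow>
        f m \<sigma> \<in> simp_set X m \<and>
        (\<forall>k. \<forall>\<phi>\<in>simplex_mor k m. f k (compose {..k} \<sigma> \<phi>) = act X k m \<phi> (f m \<sigma>)))"

text \<open>Agreement is required on \<open>K\<close> only, so a filling can be constructed along a
  chain of growing families.\<close>

definition extendable :: "'a sset \<Rightarrow> nat \<Rightarrow> nat set set \<Rightarrow> nat set set \<Rightarrow> bool" where
  "extendable X N K K' \<longleftrightarrow>
     (\<forall>f. partial_simplex X N K f \<longrightarrow> (\<exists>g. partial_simplex X N K' g \<and>
        (\<forall>m. \<forall>\<sigma>\<in>simplex_mor m N. \<sigma> ` {..m} \<in> K \<longrightarrow> g m \<sigma> = f m \<sigma>)))"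

lemma extendable_trans:
  assumes "extendable X N K K'" "extendable X N K' K''" "K \<subseteq> K'"
  shows "extendable X N K K''"
  unfolding extendable_def
proof (intro allI impI)
  fix f assume "partial_simplex X N K f"
  then obtain g where g: "partial_simplex X N K' g"
    "\<forall>m. \<forall>\<sigma>\<in>simplex_mor m N. \<sigma> ` {..m} \<in> K \<longrightarrow> g m \<sigma> = f m \<sigma>"
    using assms(1) unfolding extendable_def by metis
  then obtain h where "partial_simplex X N K'' h"
    "\<forall>m. \<forall>\<sigma>\<in>simplex_mor m N. \<sigma> ` {..m} \<in> K' \<longrightarrow> h m \<sigma> = g m \<sigma>"
    using assms(2) unfolding extendable_def by metis
  then show "\<exists>h. partial_simplex X N K'' h \<and>
      (\<forall>m. \<forall>\<sigma>\<in>simplex_mor m N. \<sigma> ` {..m} \<in> K \<longrightarrow> h m \<sigma> = f m \<sigma>)"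
    using g(2) assms(3) by (metis subsetD)
qed

text \<open>Closure of \<open>K\<close> under subsets makes \<open>A\<close> closed under operators,
  because the vertices of \<open>compose {..k} \<sigma> \<phi>\<close> are among those of
  \<open>\<sigma>\<close>. Restricting in each degree supplies the extensionality that
  \<open>sset_hom\<close> demands.\<close>

lemma partial_simplex_restrict_hom:
  assumes "partial_simplex X N K f" "\<And>U V. U \<in> K \<Longrightarrow> V \<subseteq> U \<Longrightarrow> V \<in> K"
    and "\<And>m. simp_set A m = {\<sigma>\<in>simplex_mor m N. \<sigma> ` {..m} \<in> K}" "act A = act (std_simplex N)"
  shows "(\<lambda>m. restrict (f m) (simp_set A m)) \<in> sset_hom A X"
  unfolding sset_hom_def
proof (intro CollectI conjI allI ballI)
  fix m
  show "restrict (f m) (simp_set A m) \<in> simp_set A m \<rightarrow>\<^sub>E simp_set X m"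
    using assms(1,3) by (auto simp: partial_simplex_def)
next
  fix m n \<theta> x
  assume \<theta>: "\<theta> \<in> simplex_mor m n" and x: "x \<in> simp_set A n"
  then have x': "x \<in> simplex_mor n N" "x ` {..n} \<in> K" using assms(3) by auto
  have "compose {..m} x \<theta> \<in> simp_set A m"
    using simplex_mor_compose[OF \<theta> x'(1)] assms(2)[OF x'(2) image_compose_subset[OF \<theta>]] assms(3)
    by auto
  then show "restrict (f m) (simp_set A m) (act A m n \<theta> x) =
      act X m n \<theta> (restrict (f n) (simp_set A n) x)"
    using x x' \<theta> assms(1) by (simp add: assms(4) std_simplex_def partial_simplex_def)
qed

lemma hom_partial_simplex:
  assumes "f \<in> sset_hom A X"
    and "\<And>m. simp_set A m = {\<sigma>\<in>simplex_mor m N. \<sigma> ` {..m} \<in> K}" "act A = act (std_simplex N)"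
  shows "partial_simplex X N K f"
  using assms by (auto simp: partial_simplex_def sset_hom_def std_simplex_def)

text \<open>A simplex lies in a face opposite some element of \<open>L\<close> exactly when its
  vertex set omits an element of \<open>L\<close>.\<close>

lemma extends_along_face_union_iff:
  "extends_along (face_union N L) (std_simplex N) X \<longleftrightarrow>
    extendable X N {U. \<not> L \<subseteq> U} UNIV" (is "?l \<longleftrightarrow> ?r")
proof -
  let ?A = "face_union N L" and ?B = "std_simplex N" and ?K = "{U. \<not> L \<subseteq> U}"
  have A: "simp_set ?A m = {\<sigma>\<in>simplex_mor m N. \<sigma> ` {..m} \<in> ?K}" "act ?A = act ?B" for m
    by (auto simp: face_union_def face_def)
  have B: "simp_set ?B m = {\<sigma>\<in>simplex_mor m N. \<sigma> ` {..m} \<in> UNIV}" for m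
    by (auto simp: std_simplex_def)
  show ?thesis
  proof
    assume l: ?l
    show ?r
      unfolding extendable_def
    proof (intro allI impI)
      fix f assume "partial_simplex X N ?K f"
      then have "(\<lambda>m. restrict (f m) (simp_set ?A m)) \<in> sset_hom ?A X"
        by (rule partial_simplex_restrict_hom) (use A in auto)
      then obtain g where g: "g \<in> sset_hom ?B X"
        "\<forall>m. \<forall>x\<in>simp_set ?A m. g m x = restrict (f m) (simp_set ?A m) x"
        using l unfolding extends_along_def by meson
      have "partial_simplex X N UNIV g"
        by (rule hom_partial_simplex[OF g(1)]) (use B in auto)
      with g(2) A show "\<exists>g. partial_simplex X N UNIV g \<and>
          (\<forall>m. \<forall>\<sigma>\<in>simplex_mor m N. \<sigma> ` {..m} \<in> ?K \<longrightarrow> g m \<sigma> = f m \<sigma>)"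
        by (intro exI[of _ g]) auto
    qed
  next
    assume r: ?r
    show ?l
      unfolding extends_along_def
    proof
      fix f assume "f \<in> sset_hom ?A X"
      then have "partial_simplex X N ?K f"
        by (rule hom_partial_simplex) (use A in auto)
      then obtain g where g: "partial_simplex X N UNIV g"
        "\<forall>m. \<forall>\<sigma>\<in>simplex_mor m N. \<sigma> ` {..m} \<in> ?K \<longrightarrow> g m \<sigma> = f m \<sigma>"
        using r unfolding extendable_def by meson
      have "(\<lambda>m. restrict (g m) (simp_set ?B m)) \<in> sset_hom ?B X"
        by (rule partial_simplex_restrict_hom[OF g(1)]) (use B in auto)
      with g(2) A B show "\<exists>g\<in>sset_hom ?B X. \<forall>m. \<forall>x\<in>simp_set ?A m. g m x = f m x"
        by (intro bexI) auto
    qed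
  qed
qed

text \<open>By the last assumption, the part of \<open>K\<close> inside the simplex spanned by
  \<open>e\<close> is the image of the union of faces opposite \<open>L\<close>. The enlarged family
  is thus a pushout along that union, and a filler in \<open>\<Delta>[n]\<close> is glued to the
  given map.\<close>

lemma extendable_cell:
  assumes down: "\<And>U V. U \<in> K \<Longrightarrow> V \<subseteq> U \<Longrightarrow> V \<in> K"
    and e: "e \<in> simplex_mor n N" "inj_on e {..n}"
    and fill: "extendable X n {U. \<not> L \<subseteq> U} UNIV" and L: "L \<subseteq> {..n}"
    and K: "\<And>V. V \<subseteq> e ` {..n} \<Longrightarrow> V \<in> K \<longleftrightarrow> \<not> e ` L \<subseteq> V"
  shows "extendable X N K (K \<union> Pow (e ` {..n}))"
  unfolding extendable_def
proof (intro allI impI)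
  fix f assume f: "partial_simplex X N K f"
  have "partial_simplex X n {U. \<not> L \<subseteq> U} (\<lambda>m \<tau>. f m (compose {..m} e \<tau>))"
    unfolding partial_simplex_def
  proof (intro allI ballI impI)
    fix m \<tau> assume \<tau>: "\<tau> \<in> simplex_mor m n" "\<tau> ` {..m} \<in> {U. \<not> L \<subseteq> U}"
    have im: "\<tau> ` {..m} \<subseteq> {..n}" using simplex_mor_le[OF \<tau>(1)] by auto
    obtain l where l: "l \<in> L" "l \<notin> \<tau> ` {..m}" using \<tau>(2) by auto
    then have "e l \<notin> e ` (\<tau> ` {..m})"
      using L im inj_on_image_mem_iff[OF e(2), of l "\<tau> ` {..m}"] by auto
    then have "\<not> e ` L \<subseteq> e ` (\<tau> ` {..m})" using l(1) by (auto simp del: image_image)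
    then have inK: "compose {..m} e \<tau> ` {..m} \<in> K"
      using K[of "e ` \<tau> ` {..m}"] im by (auto simp: compose_def image_image)
    show "f m (compose {..m} e \<tau>) \<in> simp_set X m \<and>
      (\<forall>k. \<forall>\<phi>\<in>simplex_mor k m.
        f k (compose {..k} e (compose {..k} \<tau> \<phi>)) = act X k m \<phi> (f m (compose {..m} e \<tau>)))"
      using f inK simplex_mor_compose[OF \<tau>(1) e(1)]
      by (auto simp: partial_simplex_def compose_simplex_mor_assoc[symmetric])
  qed
  then obtain g where g: "partial_simplex X n UNIV g"
    "\<And>m \<tau>. \<tau> \<in> simplex_mor m n \<Longrightarrow> \<not> L \<subseteq> \<tau> ` {..m} \<Longrightarrow> g m \<tau> = f m (compose {..m} e \<tau>)"
    using fill unfolding extendable_def by (metis (no_types, lifting) mem_Collect_eq)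
  \<comment> \<open>\<open>e\<close> is injective and monotone, so its inverse on the image is
    monotone as well and carries simplices on those vertices back to
    \<open>\<Delta>[n]\<close>.\<close>
  define r where "r = inv_into {..n} e"
  have er: "e (r v) = v" "r v \<le> n" if "v \<in> e ` {..n}" for v
    using that by (auto simp: r_def f_inv_into_f e(2))
  have re: "r v \<le> r w" if "v \<in> e ` {..n}" "w \<in> e ` {..n}" "v \<le> w" for v w
  proof (rule ccontr)
    assume "\<not> r v \<le> r w"
    then have "r w \<le> r v" "r w \<noteq> r v" by auto
    then have "e (r w) \<le> e (r v)" using simplex_mor_mono[OF e(1)] er that by blast
    then have "v = w" using er that by auto
    then show False using \<open>\<not> r v \<le> r w\<close> by simp
  qed
  have rmor: "compose {..m} r \<sigma> \<in> simplex_mor m n" "compose {..m} e (compose {..m} r \<sigma>) = \<sigma>"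
    if "\<sigma> \<in> simplex_mor m N" "\<sigma> ` {..m} \<subseteq> e ` {..n}" for m \<sigma>
  proof -
    have in_e: "\<sigma> k \<in> e ` {..n}" if "k \<le> m" for k using that \<open>\<sigma> ` {..m} \<subseteq> e ` {..n}\<close> by auto
    show 1: "compose {..m} r \<sigma> \<in> simplex_mor m n"
      by (rule simplex_morI)
        (auto simp: compose_def er in_e intro!: re simplex_mor_mono[OF that(1)])
    show "compose {..m} e (compose {..m} r \<sigma>) = \<sigma>"
      by (rule simplex_mor_eqI[OF simplex_mor_compose[OF 1 e(1)] that(1)])
        (simp add: compose_def er in_e)
  qed
  define h where "h m \<sigma> = (if \<sigma> ` {..m} \<in> K then f m \<sigma> else g m (compose {..m} r \<sigma>))" for m \<sigma>
  have h: "h m \<sigma> = g m (compose {..m} r \<sigma>)"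
    if \<sigma>: "\<sigma> \<in> simplex_mor m N" "\<sigma> ` {..m} \<subseteq> e ` {..n}" for m \<sigma>
  proof (cases "\<sigma> ` {..m} \<in> K")
    case True
    \<comment> \<open>On the overlap, \<open>e\<close> maps the vertices of \<open>?\<tau>\<close>
      onto those of \<open>\<sigma>\<close>; hence \<open>?\<tau>\<close> lies in the horn, where
      \<open>g\<close> is prescribed by \<open>f\<close>.\<close>
    let ?\<tau> = "compose {..m} r \<sigma>"
    have "e ` (?\<tau> ` {..m}) = compose {..m} e ?\<tau> ` {..m}"
      by (simp add: image_image compose_eq cong: image_cong_simp)
    then have "e ` (?\<tau> ` {..m}) = \<sigma> ` {..m}" by (simp only: rmor(2)[OF \<sigma>])
    then have "\<not> L \<subseteq> ?\<tau> ` {..m}" using True K[OF \<sigma>(2)] by (metis image_mono)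
    then have "g m ?\<tau> = f m \<sigma>" using g(2) rmor[OF \<sigma>] by simp
    then show ?thesis using True by (simp add: h_def)
  qed (simp add: h_def)
  have "partial_simplex X N (K \<union> Pow (e ` {..n})) h"
    unfolding partial_simplex_def
  proof (intro allI ballI impI)
    fix m \<sigma> assume \<sigma>: "\<sigma> \<in> simplex_mor m N" "\<sigma> ` {..m} \<in> K \<union> Pow (e ` {..n})"
    show "h m \<sigma> \<in> simp_set X m \<and>
      (\<forall>k. \<forall>\<phi>\<in>simplex_mor k m. h k (compose {..k} \<sigma> \<phi>) = act X k m \<phi> (h m \<sigma>))"
    proof (cases "\<sigma> ` {..m} \<in> K")
      case True
      have "compose {..k} \<sigma> \<phi> ` {..k} \<in> K" if "\<phi> \<in> simplex_mor k m" for k \<phi>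
        by (rule down[OF True image_compose_subset[OF that]])
      then show ?thesis using f \<sigma>(1) True by (simp add: h_def partial_simplex_def)
    next
      case False
      then have im: "\<sigma> ` {..m} \<subseteq> e ` {..n}" using \<sigma>(2) by auto
      have "h k (compose {..k} \<sigma> \<phi>) = act X k m \<phi> (h m \<sigma>)" if \<phi>: "\<phi> \<in> simplex_mor k m" for k \<phi>
      proof -
        have "h k (compose {..k} \<sigma> \<phi>) = g k (compose {..k} r (compose {..k} \<sigma> \<phi>))"
          by (rule h[OF simplex_mor_compose[OF \<phi> \<sigma>(1)] order_trans[OF image_compose_subset[OF \<phi>] im]])
        also have "\<dots> = g k (compose {..k} (compose {..m} r \<sigma>) \<phi>)"
          by (simp add: compose_simplex_mor_assoc[OF \<phi>])
        also have "\<dots> = act X k m \<phi> (g m (compose {..m} r \<sigma>))"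
          using g(1) rmor(1)[OF \<sigma>(1) im] \<phi> by (simp add: partial_simplex_def)
        finally show ?thesis using h[OF \<sigma>(1) im] by simp
      qed
      moreover have "h m \<sigma> \<in> simp_set X m"
        using g(1) rmor(1)[OF \<sigma>(1) im] h[OF \<sigma>(1) im] by (simp add: partial_simplex_def)
      ultimately show ?thesis by blast
    qed
  qed
  then show "\<exists>g. partial_simplex X N (K \<union> Pow (e ` {..n})) g \<and>
      (\<forall>m. \<forall>\<sigma>\<in>simplex_mor m N. \<sigma> ` {..m} \<in> K \<longrightarrow> g m \<sigma> = f m \<sigma>)"
    by (intro exI[of _ h]) (auto simp: h_def)
qed

section \<open>Cofaces and compatible families of faces\<close>

definition coface :: "nat \<Rightarrow> nat \<Rightarrow> nat \<Rightarrow> nat" where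
  "coface n l = (\<lambda>k\<in>{..n}. if k < l then k else Suc k)"

lemma coface_simplex_mor: "coface n l \<in> simplex_mor n (Suc n)"
  by (rule simplex_morI) (auto simp: coface_def)

lemma inj_on_coface: "inj_on (coface n l) {..n}"
  by (auto simp: inj_on_def coface_def split: if_splits)

lemma coface_image: "l \<le> Suc n \<Longrightarrow> coface n l ` {..n} = {..Suc n} - {l}"
proof (intro equalityI subsetI)
  fix v assume "l \<le> Suc n" "v \<in> {..Suc n} - {l}"
  then have "v = coface n l (if v < l then v else v - 1)" "(if v < l then v else v - 1) \<in> {..n}"
    by (auto simp: coface_def)
  then show "v \<in> coface n l ` {..n}" by (rule image_eqI)
qed (auto simp: coface_def)

text \<open>For a simplex \<open>\<sigma>\<close> of \<open>\<Delta>[n + 1]\<close> that misses \<open>l\<close>, this is the simplex of \<open>\<Delta>[n]\<close> from which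
  \<open>\<sigma>\<close> is obtained by the coface map.\<close>

definition coface_factor :: "nat \<Rightarrow> nat \<Rightarrow> (nat \<Rightarrow> nat) \<Rightarrow> nat \<Rightarrow> nat" where
  "coface_factor m l \<sigma> = (\<lambda>k\<in>{..m}. if \<sigma> k < l then \<sigma> k else \<sigma> k - 1)"

lemma coface_factor:
  assumes "\<sigma> \<in> simplex_mor m (Suc n)" "l \<notin> \<sigma> ` {..m}" "l \<le> Suc n"
  shows "coface_factor m l \<sigma> \<in> simplex_mor m n"
    "compose {..m} (coface n l) (coface_factor m l \<sigma>) = \<sigma>"
proof -
  have ne: "\<sigma> k \<noteq> l" "\<sigma> k \<le> Suc n" if "k \<le> m" for k
    using that assms(2) simplex_mor_le[OF assms(1)] by auto
  show 1: "coface_factor m l \<sigma> \<in> simplex_mor m n"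
  proof (rule simplex_morI)
    fix k assume "k \<le> m" then show "coface_factor m l \<sigma> k \<le> n"
      using ne[of k] assms(3) by (auto simp: coface_factor_def)
  next
    fix k k' assume k: "k \<le> k'" "k' \<le> m"
    then show "coface_factor m l \<sigma> k \<le> coface_factor m l \<sigma> k'"
      using simplex_mor_mono[OF assms(1) k] by (auto simp: coface_factor_def)
  qed (simp add: coface_factor_def)
  have "coface n l (coface_factor m l \<sigma> k) = \<sigma> k" if "k \<le> m" for k
    using ne[OF that] that simplex_mor_le[OF 1 that] by (auto simp: coface_def coface_factor_def)
  then show "compose {..m} (coface n l) (coface_factor m l \<sigma>) = \<sigma>"
    by (intro simplex_mor_eqI[OF simplex_mor_compose[OF 1 coface_simplex_mor] assms(1)])
      (auto simp: compose_def)
qed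

lemma coface_factor_compose:
  "\<phi> \<in> simplex_mor k m \<Longrightarrow>
    coface_factor k l (compose {..k} \<sigma> \<phi>) = compose {..k} (coface_factor m l \<sigma>) \<phi>"
  by (auto simp: coface_factor_def compose_def fun_eq_iff simplex_mor_le)

lemma coface_factor_coface: "coface_factor n l (coface n l) = restrict id {..n}"
  by (auto simp: coface_factor_def coface_def fun_eq_iff)

lemma coface_coface:
  "a < b \<Longrightarrow> compose {..n} (coface (Suc n) b) (coface n a) =
    compose {..n} (coface (Suc n) a) (coface n (b - 1))"
  by (auto simp: coface_def compose_def fun_eq_iff)

definition face_op :: "'a sset \<Rightarrow> nat \<Rightarrow> nat \<Rightarrow> 'a \<Rightarrow> 'a" where
  "face_op X n l = act X n (Suc n) (coface n l)"

text \<open>A horn given by its facets, subject to the simplicial identity on their pairwise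
  intersections. The filler has dimension \<open>n + 2\<close>, so that the faces of its faces have
  dimension \<open>n\<close> and always exist.\<close>

definition fillable :: "'a sset \<Rightarrow> nat \<Rightarrow> nat set \<Rightarrow> bool" where
  "fillable X n L \<longleftrightarrow>
     (\<forall>x. (\<forall>l\<in>L. x l \<in> simp_set X (Suc n)) \<and>
          (\<forall>a\<in>L. \<forall>b\<in>L. a < b \<longrightarrow> face_op X n a (x b) = face_op X n (b - 1) (x a)) \<longrightarrow>
        (\<exists>y\<in>simp_set X (Suc (Suc n)). \<forall>l\<in>L. face_op X (Suc n) l y = x l))"

text \<open>A simplex that omits both \<open>a\<close> and \<open>b\<close> factors through the
  intersection of the two faces, where compatibility applies.\<close>

lemma compatible_faces_agree:
  assumes X: "simplicial_set X" and ab: "a < b" "b \<le> Suc (Suc n)"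
    and x: "x a \<in> simp_set X (Suc n)" "x b \<in> simp_set X (Suc n)"
      "face_op X n a (x b) = face_op X n (b - 1) (x a)"
    and \<sigma>: "\<sigma> \<in> simplex_mor m (Suc (Suc n))" "a \<notin> \<sigma> ` {..m}" "b \<notin> \<sigma> ` {..m}"
  shows "act X m (Suc n) (coface_factor m a \<sigma>) (x a) = act X m (Suc n) (coface_factor m b \<sigma>) (x b)"
proof -
  let ?a = "coface_factor m a \<sigma>" and ?b = "coface_factor m b \<sigma>"
  have a: "?a \<in> simplex_mor m (Suc n)" and b: "?b \<in> simplex_mor m (Suc n)"
    using coface_factor(1)[OF \<sigma>(1)] \<sigma>(2,3) ab by auto
  have ne: "\<sigma> k \<noteq> a" "\<sigma> k \<noteq> b" if "k \<le> m" for k using \<sigma> that by auto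
  have "?a k \<noteq> b - 1 \<and> ?b k \<noteq> a" if "k \<le> m" for k
    using ab ne[OF that] that unfolding coface_factor_def by (simp, linarith)
  then have a': "b - 1 \<notin> ?a ` {..m}" and b': "a \<notin> ?b ` {..m}"
    unfolding image_iff atMost_iff Bex_def by metis+
  let ?c = "coface_factor m a ?b"
  have c: "?c \<in> simplex_mor m n" "compose {..m} (coface n a) ?c = ?b"
    using coface_factor[OF b b'] ab by auto
  \<comment> \<open>Vertices \<open>a\<close> and \<open>b\<close> are removed in either order;
    since \<open>a < b\<close>, removing \<open>a\<close> first turns \<open>b\<close> into
    \<open>b - 1\<close>.\<close>
  have c': "?c = coface_factor m (b - 1) ?a"
    using ab ne by (fastforce simp: coface_factor_def fun_eq_iff)
  have "compose {..m} (coface n (b - 1)) ?c = ?a"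
    using coface_factor(2)[OF a a'] ab by (simp add: c')
  then have "act X m (Suc n) ?a (x a) = act X m n ?c (face_op X n (b - 1) (x a))"
    using simplicial_act_compose[OF X c(1) coface_simplex_mor x(1)] by (simp add: face_op_def)
  also have "\<dots> = act X m (Suc n) ?b (x b)"
    using simplicial_act_compose[OF X c(1) coface_simplex_mor x(2)] c(2)
    unfolding x(3)[symmetric] by (simp add: face_op_def)
  finally show ?thesis .
qed

text \<open>A union of faces is glued from these faces along their pairwise intersections, and a map
  on a single face is given by a simplex of X.\<close>

lemma extendable_iff_fillable:
  assumes X: "simplicial_set X" and L: "L \<subseteq> {..Suc (Suc n)}"
  shows "extendable X (Suc (Suc n)) {U. \<not> L \<subseteq> U} UNIV \<longleftrightarrow> fillable X n L" (is "?l \<longleftrightarrow> ?r")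
proof
  assume l: ?l
  show ?r
    unfolding fillable_def
  proof (intro allI impI)
    fix x
    assume "(\<forall>l\<in>L. x l \<in> simp_set X (Suc n)) \<and>
      (\<forall>a\<in>L. \<forall>b\<in>L. a < b \<longrightarrow> face_op X n a (x b) = face_op X n (b - 1) (x a))"
    then have x: "\<And>l. l \<in> L \<Longrightarrow> x l \<in> simp_set X (Suc n)"
      "\<And>a b. a \<in> L \<Longrightarrow> b \<in> L \<Longrightarrow> a < b \<Longrightarrow> face_op X n a (x b) = face_op X n (b - 1) (x a)"
      by auto
    \<comment> \<open>A simplex may omit several elements of \<open>L\<close>. Any of them may be
      chosen, since \<open>compatible_faces_agree\<close> makes the value independent of the
      choice.\<close>
    define f where "f m \<sigma> = (let l = (SOME l. l \<in> L \<and> l \<notin> \<sigma> ` {..m}) in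
      act X m (Suc n) (coface_factor m l \<sigma>) (x l))" for m \<sigma>
    have f: "f m \<sigma> = act X m (Suc n) (coface_factor m l \<sigma>) (x l)"
      if \<sigma>: "\<sigma> \<in> simplex_mor m (Suc (Suc n))" and l: "l \<in> L" "l \<notin> \<sigma> ` {..m}" for m \<sigma> l
    proof -
      define l' where "l' = (SOME l. l \<in> L \<and> l \<notin> \<sigma> ` {..m})"
      have l': "l' \<in> L" "l' \<notin> \<sigma> ` {..m}"
        using someI[of "\<lambda>l. l \<in> L \<and> l \<notin> \<sigma> ` {..m}" l] l by (auto simp: l'_def)
      have "act X m (Suc n) (coface_factor m l' \<sigma>) (x l') = act X m (Suc n) (coface_factor m l \<sigma>) (x l)"
      proof (cases l l' rule: linorder_cases)
        case less
        then show ?thesis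
          using compatible_faces_agree[OF X less, of n x \<sigma> m] x l l' L \<sigma> by auto
      next
        case greater
        then show ?thesis
          using compatible_faces_agree[OF X greater, of n x \<sigma> m] x l l' L \<sigma> by auto
      qed simp
      then show ?thesis by (simp add: f_def Let_def l'_def)
    qed
    have "partial_simplex X (Suc (Suc n)) {U. \<not> L \<subseteq> U} f"
      unfolding partial_simplex_def
    proof (intro allI ballI impI)
      fix m \<sigma>
      assume \<sigma>: "\<sigma> \<in> simplex_mor m (Suc (Suc n))" "\<sigma> ` {..m} \<in> {U. \<not> L \<subseteq> U}"
      then obtain l where l: "l \<in> L" "l \<notin> \<sigma> ` {..m}" by auto
      have l_le: "l \<le> Suc (Suc n)" using l L by auto
      have red: "coface_factor m l \<sigma> \<in> simplex_mor m (Suc n)"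
        by (rule coface_factor(1)[OF \<sigma>(1) l(2) l_le])
      have "f k (compose {..k} \<sigma> \<phi>) = act X k m \<phi> (f m \<sigma>)" if \<phi>: "\<phi> \<in> simplex_mor k m" for k \<phi>
      proof -
        have "l \<notin> compose {..k} \<sigma> \<phi> ` {..k}"
          by (rule contra_subsetD[OF image_compose_subset[OF \<phi>] l(2)])
        then have "f k (compose {..k} \<sigma> \<phi>) =
            act X k (Suc n) (compose {..k} (coface_factor m l \<sigma>) \<phi>) (x l)"
          using f[OF simplex_mor_compose[OF \<phi> \<sigma>(1)] l(1)] coface_factor_compose[OF \<phi>] by simp
        then show ?thesis
          using simplicial_act_compose[OF X \<phi> red x(1)[OF l(1)]] f[OF \<sigma>(1) l] by simp
      qed
      then show "f m \<sigma> \<in> simp_set X m \<and>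
          (\<forall>k. \<forall>\<phi>\<in>simplex_mor k m. f k (compose {..k} \<sigma> \<phi>) = act X k m \<phi> (f m \<sigma>))"
        using f[OF \<sigma>(1) l] simplicial_act_in[OF X red x(1)[OF l(1)]] by simp
    qed
    then obtain g where g: "partial_simplex X (Suc (Suc n)) UNIV g"
      "\<And>m \<sigma>. \<sigma> \<in> simplex_mor m (Suc (Suc n)) \<Longrightarrow> \<not> L \<subseteq> \<sigma> ` {..m} \<Longrightarrow> g m \<sigma> = f m \<sigma>"
      using l unfolding extendable_def by (metis (no_types, lifting) mem_Collect_eq)
    \<comment> \<open>The extension is evaluated at the top simplex of
      \<open>\<Delta>[n + 2]\<close>; naturality identifies the faces of this value.\<close>
    let ?i = "restrict id {..Suc (Suc n)}"
    have "face_op X (Suc n) l (g (Suc (Suc n)) ?i) = x l" if l: "l \<in> L" for l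
    proof -
      have l_nin: "l \<notin> coface (Suc n) l ` {..Suc n}" by (auto simp: coface_def)
      have "face_op X (Suc n) l (g (Suc (Suc n)) ?i) = g (Suc n) (compose {..Suc n} ?i (coface (Suc n) l))"
        using g(1) simplex_mor_id[of "Suc (Suc n)"] coface_simplex_mor[of "Suc n" l]
        unfolding partial_simplex_def face_op_def by auto
      also have "\<dots> = g (Suc n) (coface (Suc n) l)"
        by (simp add: compose_restrict_id[OF coface_simplex_mor])
      also have "\<dots> = f (Suc n) (coface (Suc n) l)"
        using g(2)[OF coface_simplex_mor, of l] l l_nin by blast
      also have "\<dots> = x l"
        using f[OF coface_simplex_mor l l_nin] simplicial_act_id[OF X x(1)[OF l]]
        by (simp add: coface_factor_coface)
      finally show ?thesis .
    qed
    moreover have "g (Suc (Suc n)) ?i \<in> simp_set X (Suc (Suc n))"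
      using g(1) simplex_mor_id by (auto simp: partial_simplex_def)
    ultimately show "\<exists>y\<in>simp_set X (Suc (Suc n)). \<forall>l\<in>L. face_op X (Suc n) l y = x l"
      by blast
  qed
next
  assume r: ?r
  show ?l
    unfolding extendable_def
  proof (intro allI impI)
    fix f assume f: "partial_simplex X (Suc (Suc n)) {U. \<not> L \<subseteq> U} f"
    let ?x = "\<lambda>l. f (Suc n) (coface (Suc n) l)"
    have nin: "\<not> L \<subseteq> coface (Suc n) l ` {..Suc n}" if "l \<in> L" for l
      using that by (auto simp: coface_def subset_iff image_iff intro!: bexI[of _ l])
    have nat: "f k (compose {..k} (coface (Suc n) l) \<phi>) = act X k (Suc n) \<phi> (?x l)"
      if "l \<in> L" "\<phi> \<in> simplex_mor k (Suc n)" for l k \<phi>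
      using f nin[OF that(1)] coface_simplex_mor that(2) by (auto simp: partial_simplex_def)
    have "?x l \<in> simp_set X (Suc n)" if "l \<in> L" for l
      using f nin[OF that] coface_simplex_mor by (auto simp: partial_simplex_def)
    moreover have "face_op X n a (?x b) = face_op X n (b - 1) (?x a)"
      if "a \<in> L" "b \<in> L" "a < b" for a b
      using nat[OF that(1) coface_simplex_mor, of "b - 1"] nat[OF that(2) coface_simplex_mor, of a]
      by (simp only: face_op_def coface_coface[OF that(3)])
    ultimately have "\<exists>y\<in>simp_set X (Suc (Suc n)). \<forall>l\<in>L. face_op X (Suc n) l y = ?x l"
      by (intro r[unfolded fillable_def, rule_format]) blast
    then obtain y where y: "y \<in> simp_set X (Suc (Suc n))"
      "\<And>l. l \<in> L \<Longrightarrow> face_op X (Suc n) l y = ?x l" by blast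
    \<comment> \<open>The map classified by \<open>y\<close>; on the horn it is determined by the
      faces of \<open>y\<close>.\<close>
    let ?g = "\<lambda>m \<sigma>. act X m (Suc (Suc n)) \<sigma> y"
    have "partial_simplex X (Suc (Suc n)) UNIV ?g"
      using simplicial_act_in[OF X _ y(1)] simplicial_act_compose[OF X _ _ y(1)]
      by (simp add: partial_simplex_def)
    moreover have "?g m \<sigma> = f m \<sigma>"
      if \<sigma>: "\<sigma> \<in> simplex_mor m (Suc (Suc n))" and miss: "\<sigma> ` {..m} \<in> {U. \<not> L \<subseteq> U}" for m \<sigma>
    proof -
      obtain l where l: "l \<in> L" "l \<notin> \<sigma> ` {..m}" using miss by auto
      then have "l \<le> Suc (Suc n)" using L by auto
      note red = coface_factor[OF \<sigma> l(2) this]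
      have "?g m \<sigma> = act X m (Suc n) (coface_factor m l \<sigma>) (face_op X (Suc n) l y)"
        using simplicial_act_compose[OF X red(1) coface_simplex_mor y(1), of l] red(2)
        by (simp add: face_op_def)
      then show ?thesis using nat[OF l(1) red(1)] red(2) y(2)[OF l(1)] by simp
    qed
    ultimately show "\<exists>g. partial_simplex X (Suc (Suc n)) UNIV g \<and>
        (\<forall>m. \<forall>\<sigma>\<in>simplex_mor m (Suc (Suc n)). \<sigma> ` {..m} \<in> {U. \<not> L \<subseteq> U} \<longrightarrow> g m \<sigma> = f m \<sigma>)"
      by blast
  qed
qed


section \<open>Reduction to 2-Segal horns at an outer vertex\<close>

definition segal_fillable :: "'a sset \<Rightarrow> nat \<Rightarrow> nat \<Rightarrow> nat \<Rightarrow> bool" where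
  "segal_fillable X n p q \<longleftrightarrow> extendable X n {U. \<not> {..n} - {p, q} \<subseteq> U} UNIV"

text \<open>Naming the attached simplex by its vertex set \<open>S\<close> reduces each attachment
  to one check: which two facets of \<open>S\<close> are still missing from
  \<open>K\<close>.\<close>

lemma extendable_segal_cell:
  assumes "\<And>U V. U \<in> K \<Longrightarrow> V \<subseteq> U \<Longrightarrow> V \<in> K"
    and e: "e \<in> simplex_mor n N" "inj_on e {..n}" "e ` {..n} = S"
    and fill: "segal_fillable X n p q" "p \<le> n" "q \<le> n"
    and K: "\<And>V. V \<subseteq> S \<Longrightarrow> V \<in> K \<longleftrightarrow> \<not> S - {e p, e q} \<subseteq> V"
  shows "extendable X N K (K \<union> Pow S)"
proof -
  have "e ` ({..n} - {p, q}) = e ` {..n} - e ` {p, q}"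
    using fill(2,3) by (intro inj_on_image_set_diff[OF e(2)]) auto
  then have "e ` ({..n} - {p, q}) = S - {e p, e q}" using e(3) by simp
  then have "extendable X N K (K \<union> Pow (e ` {..n}))"
    using assms by (intro extendable_cell[OF assms(1) e(1,2) fill(1)[unfolded segal_fillable_def]]) auto
  then show ?thesis by (simp add: e(3))
qed

text \<open>The horn missing the faces \<open>i\<close> and \<open>j\<close> is pulled back along the degeneracy \<open>[n + 1] \<rightarrow> [n]\<close>
  that identifies 0 and 1. From a part \<open>K\<^sub>0\<close> of the pullback all of \<open>\<Delta>[n + 1]\<close> is reached by
  filling five 2-Segal horns: four of them miss an outer face, and the third one has the same shape
  as the given horn, but with fewer vertices after \<open>j\<close>. Restricting the result to the face opposite
  0 gives the required simplex.\<close>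

lemma segal_fillable_inner:
  assumes ij: "0 < i" "i + 2 \<le> j" "j < n"
    and left: "\<And>N q. 2 \<le> q \<Longrightarrow> q < N \<Longrightarrow> segal_fillable X N 0 q"
    and right: "\<And>N p. 1 \<le> p \<Longrightarrow> p + 2 \<le> N \<Longrightarrow> segal_fillable X N p N"
    and IH: "segal_fillable X n (Suc i) (Suc j)"
  shows "segal_fillable X n i j"
  unfolding segal_fillable_def extendable_def
proof (intro allI impI)
  fix f assume f: "partial_simplex X n {U. \<not> {..n} - {i, j} \<subseteq> U} f"
  obtain n0 where n: "n = Suc n0" using ij by (cases n) auto
  define c where "c = Suc i"
  define d where "d = Suc j"
  \<comment> \<open>Five vertices of \<open>[n + 1]\<close> play a special part: 0, 1,
    \<open>c\<close>, \<open>d\<close> and \<open>Suc n\<close>. \<open>B\<close> consists of all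
    others.\<close>
  define B where "B = {2..n} - {c, d}"
  define s where "s = (\<lambda>k\<in>{..Suc n}. k - 1)"
  define S1 where "S1 = {..Suc n} - {1, d}"
  define S2 where "S2 = {..Suc n} - {1}"
  define S3 where "S3 = {..Suc n} - {Suc n}"
  define S4 where "S4 = {..Suc n} - {d}"
  define S5 where "S5 = {..Suc n}"
  \<comment> \<open>Generated by the faces opposite the elements of \<open>B\<close> and by a copy
    of the given horn in the face opposite 0. A set that contains \<open>B\<close> and 0 but not
    \<open>Suc n\<close> is excluded, although \<open>s\<close> maps it into the horn.\<close>
  define K0 where "K0 = {U. \<not> B \<subseteq> U \<or> 0 \<notin> U \<and> \<not> {1, Suc n} \<subseteq> U}"
  define K1 where "K1 = K0 \<union> Pow S1"
  define K2 where "K2 = K1 \<union> Pow S2"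
  define K3 where "K3 = K2 \<union> Pow S3"
  define K4 where "K4 = K3 \<union> Pow S4"
  define K5 where "K5 = K4 \<union> Pow S5"
  have down0: "U \<in> K0 \<Longrightarrow> V \<subseteq> U \<Longrightarrow> V \<in> K0" for U V by (auto simp: K0_def)
  have down1: "U \<in> K1 \<Longrightarrow> V \<subseteq> U \<Longrightarrow> V \<in> K1" for U V using down0 by (auto simp: K1_def)
  have down2: "U \<in> K2 \<Longrightarrow> V \<subseteq> U \<Longrightarrow> V \<in> K2" for U V using down1 by (auto simp: K2_def)
  have down3: "U \<in> K3 \<Longrightarrow> V \<subseteq> U \<Longrightarrow> V \<in> K3" for U V using down2 by (auto simp: K3_def)
  have down4: "U \<in> K4 \<Longrightarrow> V \<subseteq> U \<Longrightarrow> V \<in> K4" for U V using down3 by (auto simp: K4_def)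
  \<comment> \<open>The facets of \<open>S1\<close> in \<open>K0\<close> are those opposite 0 and
    opposite \<open>B\<close>, which leaves \<open>c\<close> and the last vertex as the missing
    pair. \<open>S1\<close> is the facet of \<open>S2\<close> opposite \<open>d\<close>, needed
    next.\<close>
  have e1: "extendable X (Suc n) K0 K1"
    unfolding K1_def
  proof (rule extendable_segal_cell[OF down0, where n = n0 and p = i and q = n0
        and e = "compose {..n0} (coface n 1) (coface n0 j)"])
    let ?e = "compose {..n0} (coface n 1) (coface n0 j)"
    show "?e \<in> simplex_mor n0 (Suc n)"
      unfolding n by (rule simplex_mor_compose[OF coface_simplex_mor coface_simplex_mor])
    show "inj_on ?e {..n0}"
      by (auto simp: inj_on_def compose_def coface_def n split: if_splits)
    have "?e ` {..n0} = coface n 1 ` (coface n0 j ` {..n0})"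
      by (auto simp: compose_def image_image)
    also have "\<dots> = coface n 1 ` ({..n} - {j})"
      using ij by (subst coface_image) (auto simp: n)
    also have "\<dots> = coface n 1 ` {..n} - coface n 1 ` {j}"
      using ij by (intro inj_on_image_set_diff[OF inj_on_coface]) auto
    also have "\<dots> = S1"
      using ij coface_image[of 1 n] by (auto simp: S1_def d_def coface_def)
    finally show "?e ` {..n0} = S1" .
    have e: "?e i = c" "?e n0 = Suc n" using ij by (auto simp: compose_def coface_def c_def n)
    fix V assume V: "V \<subseteq> S1"
    have "S1 - {?e i, ?e n0} = insert 0 B"
      using ij unfolding e by (auto simp: S1_def B_def c_def d_def)
    then show "V \<in> K0 \<longleftrightarrow> \<not> S1 - {?e i, ?e n0} \<subseteq> V"
      using V by (auto simp: K0_def S1_def)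
  qed (use ij n in \<open>auto intro: right\<close>)
  \<comment> \<open>\<open>K0\<close> lacks three facets of \<open>S2\<close>, those opposite
    \<open>c\<close>, \<open>d\<close> and \<open>Suc n\<close>; \<open>S1\<close> has supplied the
    one opposite \<open>d\<close>.\<close>
  have e2: "extendable X (Suc n) K1 K2"
    unfolding K2_def
  proof (rule extendable_segal_cell[OF down1, where n = n and p = i and q = n and e = "coface n 1"])
    have e: "coface n 1 i = c" "coface n 1 n = Suc n" using ij by (auto simp: coface_def c_def)
    fix V assume V: "V \<subseteq> S2"
    have "S2 - {coface n 1 i, coface n 1 n} = insert 0 (insert d B)"
      using ij unfolding e by (auto simp: S2_def B_def c_def d_def)
    then show "V \<in> K1 \<longleftrightarrow> \<not> S2 - {coface n 1 i, coface n 1 n} \<subseteq> V"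
      using V by (auto simp: K1_def K0_def S1_def S2_def)
  qed (use ij in \<open>simp_all add: S2_def right coface_simplex_mor inj_on_coface coface_image\<close>)
  \<comment> \<open>With both copies of 0 kept and the last vertex dropped, \<open>c\<close> and
    \<open>d\<close> are the vertices \<open>i + 1\<close> and \<open>j + 1\<close> of
    \<open>[n]\<close>. The facet opposite 1 comes from \<open>S2\<close>, the one opposite 0 from
    \<open>K0\<close>.\<close>
  have e3: "extendable X (Suc n) K2 K3"
    unfolding K3_def
  proof (rule extendable_segal_cell[OF down2, where n = n and p = "Suc i" and q = "Suc j"
        and e = "coface n (Suc n)"])
    let ?e = "coface n (Suc n)"
    have e: "?e (Suc i) = c" "?e (Suc j) = d" using ij by (auto simp: coface_def c_def d_def)
    fix V assume V: "V \<subseteq> S3"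
    have "S3 - {?e (Suc i), ?e (Suc j)} = insert 0 (insert 1 B)"
      using ij unfolding e by (auto simp: S3_def B_def c_def d_def)
    then show "V \<in> K2 \<longleftrightarrow> \<not> S3 - {?e (Suc i), ?e (Suc j)} \<subseteq> V"
      using V by (auto simp: K2_def K1_def K0_def S1_def S2_def S3_def)
  qed (use ij in \<open>simp_all add: S3_def IH coface_simplex_mor inj_on_coface coface_image\<close>)
  \<comment> \<open>The facet of \<open>S4\<close> opposite 0 contains \<open>B\<close>, 1 and
    \<open>Suc n\<close>, hence occurs in no earlier family. The missing pair is therefore 0 and
    \<open>c\<close>.\<close>
  have e4: "extendable X (Suc n) K3 K4"
    unfolding K4_def
  proof (rule extendable_segal_cell[OF down3, where n = n and p = 0 and q = "Suc i" and e = "coface n d"])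
    have e: "coface n d 0 = 0" "coface n d (Suc i) = c" using ij by (auto simp: coface_def c_def d_def)
    fix V assume V: "V \<subseteq> S4"
    have "S4 - {coface n d 0, coface n d (Suc i)} = insert 1 (insert (Suc n) B)"
      using ij unfolding e by (auto simp: S4_def B_def c_def d_def)
    then show "V \<in> K3 \<longleftrightarrow> \<not> S4 - {coface n d 0, coface n d (Suc i)} \<subseteq> V"
      using V by (auto simp: K3_def K2_def K1_def K0_def S1_def S2_def S3_def S4_def)
  qed (use ij in \<open>simp_all add: S4_def d_def left coface_simplex_mor inj_on_coface coface_image\<close>)
  \<comment> \<open>\<open>S4\<close> supplies the facet opposite \<open>d\<close>, so only those
    opposite 0 and \<open>c\<close> are absent, and the one opposite 0 is the simplex
    sought.\<close>
  have e5: "extendable X (Suc n) K4 K5"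
    unfolding K5_def
  proof (rule extendable_segal_cell[OF down4, where n = "Suc n" and p = 0 and q = "Suc i"
        and e = "restrict id {..Suc n}"])
    let ?e = "restrict id {..Suc n}"
    have e: "?e 0 = 0" "?e (Suc i) = c" using ij by (auto simp: c_def)
    fix V assume V: "V \<subseteq> S5"
    have "S5 - {?e 0, ?e (Suc i)} = insert 1 (insert (Suc n) (insert d B))"
      using ij unfolding e by (auto simp: S5_def B_def c_def d_def)
    then show "V \<in> K4 \<longleftrightarrow> \<not> S5 - {?e 0, ?e (Suc i)} \<subseteq> V"
      using V by (auto simp: K4_def K3_def K2_def K1_def K0_def S1_def S2_def S3_def S4_def S5_def)
  qed (use ij in \<open>simp_all add: S5_def left simplex_mor_id\<close>)
  have "K0 \<subseteq> K1" "K0 \<subseteq> K2" "K0 \<subseteq> K3" "K0 \<subseteq> K4"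
    unfolding K4_def K3_def K2_def K1_def by blast+
  then have ext: "extendable X (Suc n) K0 K5"
    by (intro extendable_trans[OF _ e5] extendable_trans[OF _ e4] extendable_trans[OF _ e3]
        extendable_trans[OF e1 e2])
  have s: "s \<in> simplex_mor (Suc n) n" by (rule simplex_morI) (auto simp: s_def)
  \<comment> \<open>\<open>K0\<close> lies in the pullback along \<open>s\<close>: omitting an
    element \<open>b\<close> of \<open>B\<close>, both 0 and 1, or \<open>Suc n\<close> makes the
    image omit \<open>b - 1\<close>, 0 or \<open>n\<close>. These differ from \<open>i\<close> and
    \<open>j\<close>, the last two because \<open>0 < i\<close> and \<open>j < n\<close>.\<close>
  have sK0: "\<not> {..n} - {i, j} \<subseteq> s ` U" if U: "U \<in> K0" "U \<subseteq> {..Suc n}" for U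
  proof -
    consider b where "b \<in> B" "b \<notin> U" | "0 \<notin> U" "1 \<notin> U" | "Suc n \<notin> U"
      using U(1) by (auto simp: K0_def)
    then show ?thesis
    proof cases
      case 1
      then have "b - 1 \<in> {..n} - {i, j}" using ij by (auto simp: B_def c_def d_def)
      moreover have "b - 1 \<notin> s ` U"
      proof
        assume "b - 1 \<in> s ` U"
        then obtain u where "u \<in> U" "b - 1 = u - 1" using U(2) by (auto simp: s_def)
        then have "u = b" using 1 by (auto simp: B_def)
        then show False using 1 \<open>u \<in> U\<close> by simp
      qed
      ultimately show ?thesis by blast
    next
      case 2
      have "0 \<notin> s ` U"
      proof
        assume "0 \<in> s ` U"
        then obtain u where "u \<in> U" "0 = u - 1" using U(2) by (auto simp: s_def)
        then have "u = 0 \<or> u = 1" by auto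
        then show False using 2 \<open>u \<in> U\<close> by auto
      qed
      then show ?thesis using ij by auto
    next
      case 3
      have "n \<notin> s ` U"
      proof
        assume "n \<in> s ` U"
        then obtain u where "u \<in> U" "n = u - 1" using U(2) by (auto simp: s_def)
        then show False using 3 ij by auto
      qed
      then show ?thesis using ij by auto
    qed
  qed
  have "partial_simplex X (Suc n) K0 (\<lambda>m \<sigma>. f m (compose {..m} s \<sigma>))"
    unfolding partial_simplex_def
  proof (intro allI ballI impI)
    fix m \<sigma> assume \<sigma>: "\<sigma> \<in> simplex_mor m (Suc n)" "\<sigma> ` {..m} \<in> K0"
    have "\<sigma> ` {..m} \<subseteq> {..Suc n}" using simplex_mor_le[OF \<sigma>(1)] by auto
    then have "\<not> {..n} - {i, j} \<subseteq> compose {..m} s \<sigma> ` {..m}"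
      using sK0[OF \<sigma>(2)] by (simp add: compose_def image_image)
    then show "f m (compose {..m} s \<sigma>) \<in> simp_set X m \<and> (\<forall>k. \<forall>\<phi>\<in>simplex_mor k m.
        f k (compose {..k} s (compose {..k} \<sigma> \<phi>)) = act X k m \<phi> (f m (compose {..m} s \<sigma>)))"
      using f simplex_mor_compose[OF \<sigma>(1) s]
      by (auto simp: partial_simplex_def compose_simplex_mor_assoc[symmetric])
  qed
  then obtain g where g: "partial_simplex X (Suc n) K5 g"
    "\<And>m \<sigma>. \<sigma> \<in> simplex_mor m (Suc n) \<Longrightarrow> \<sigma> ` {..m} \<in> K0 \<Longrightarrow> g m \<sigma> = f m (compose {..m} s \<sigma>)"
    using ext unfolding extendable_def by (metis (no_types, lifting))
  \<comment> \<open>A section of \<open>s\<close>, so precomposition with it recovers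
    \<open>f\<close> on the given horn.\<close>
  let ?\<delta> = "coface n 0"
  have \<delta>: "compose {..m} ?\<delta> \<sigma> \<in> simplex_mor m (Suc n)" if "\<sigma> \<in> simplex_mor m n" for m \<sigma>
    by (rule simplex_mor_compose[OF that coface_simplex_mor])
  have K5: "\<tau> ` {..m} \<in> K5" if "\<tau> \<in> simplex_mor m (Suc n)" for m \<tau>
    using simplex_mor_le[OF that] by (auto simp: K5_def S5_def)
  have "partial_simplex X n UNIV (\<lambda>m \<sigma>. g m (compose {..m} ?\<delta> \<sigma>))"
    using g(1) \<delta> K5[OF \<delta>]
    by (auto simp: partial_simplex_def compose_simplex_mor_assoc[symmetric])
  moreover have "g m (compose {..m} ?\<delta> \<sigma>) = f m \<sigma>"
    if \<sigma>: "\<sigma> \<in> simplex_mor m n" "\<sigma> ` {..m} \<in> {U. \<not> {..n} - {i, j} \<subseteq> U}" for m \<sigma>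
  proof -
    let ?U = "compose {..m} ?\<delta> \<sigma> ` {..m}"
    have U: "?U = Suc ` \<sigma> ` {..m}"
      using simplex_mor_le[OF \<sigma>(1)] by (auto simp: compose_def coface_def image_image)
    \<comment> \<open>Omitting \<open>l\<close> becomes omitting \<open>Suc l\<close>, which is 1 or
      \<open>Suc n\<close> at the two ends. As 0 is omitted too, every case lands in
      \<open>K0\<close>.\<close>
    obtain l where l: "l \<le> n" "l \<noteq> i" "l \<noteq> j" "l \<notin> \<sigma> ` {..m}" using \<sigma>(2) by auto
    then have "Suc l \<notin> ?U" "0 \<notin> ?U" unfolding U by auto
    moreover have "Suc l \<in> insert 1 (insert (Suc n) B)" using l by (auto simp: B_def c_def d_def)
    ultimately have "?U \<in> K0" by (auto simp: K0_def)
    then have "g m (compose {..m} ?\<delta> \<sigma>) = f m (compose {..m} s (compose {..m} ?\<delta> \<sigma>))"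
      by (rule g(2)[OF \<delta>[OF \<sigma>(1)]])
    also have "compose {..m} s (compose {..m} ?\<delta> \<sigma>) = \<sigma>"
      using simplex_mor_le[OF \<sigma>(1)]
      by (intro simplex_mor_eqI[OF simplex_mor_compose[OF \<delta>[OF \<sigma>(1)] s] \<sigma>(1)])
        (auto simp: compose_def coface_def s_def)
    finally show ?thesis .
  qed
  ultimately show "\<exists>g. partial_simplex X n UNIV g \<and> (\<forall>m. \<forall>\<sigma>\<in>simplex_mor m n.
      \<sigma> ` {..m} \<in> {U. \<not> {..n} - {i, j} \<subseteq> U} \<longrightarrow> g m \<sigma> = f m \<sigma>)"
    by (intro exI[of _ "\<lambda>m \<sigma>. g m (compose {..m} ?\<delta> \<sigma>)"]) blast
qed

lemma segal_fillable_if_outer: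
  assumes left: "\<And>N q. 2 \<le> q \<Longrightarrow> q < N \<Longrightarrow> segal_fillable X N 0 q"
    and right: "\<And>N p. 1 \<le> p \<Longrightarrow> p + 2 \<le> N \<Longrightarrow> segal_fillable X N p N"
    and "i + 2 \<le> j" "j \<le> n" "0 < i \<or> j < n"
  shows "segal_fillable X n i j"
  using assms(3-5)
proof (induction "n - j" arbitrary: i j)
  case 0
  then have "j = n" by simp
  with 0 show ?case using right[of i n] by auto
next
  case (Suc r)
  then have j: "j < n" by simp
  show ?case
  proof (cases "i = 0")
    case True
    then show ?thesis using Suc j by (auto intro: left)
  next
    case False
    \<comment> \<open>The gap is unchanged and \<open>n - j\<close> drops by one. Since
      \<open>Suc i\<close> is positive, the shifted pair remains admissible even if
      \<open>Suc j = n\<close>.\<close>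
    have "segal_fillable X n (Suc i) (Suc j)" using Suc False j by (intro Suc.hyps(1)) auto
    then show ?thesis using segal_fillable_inner[OF _ _ j left right] False Suc.prems(1) by auto
  qed
qed

section \<open>Simplices of joins of standard simplices\<close>

text \<open>The isomorphism \<open>\<Delta>[a] \<star> \<Delta>[b] \<cong> \<Delta>[a + b + 1]\<close>.\<close>

fun join_vertices :: "nat \<Rightarrow> nat \<Rightarrow> (nat \<Rightarrow> nat, nat \<Rightarrow> nat) join_simplex \<Rightarrow> nat \<Rightarrow> nat" where
  "join_vertices a m (JoinLeft \<sigma>) = \<sigma>"
| "join_vertices a m (JoinRight \<tau>) = (\<lambda>k\<in>{..m}. \<tau> k + Suc a)"
| "join_vertices a m (JoinBoth p \<sigma> \<tau>) =
     (\<lambda>k\<in>{..m}. if k \<le> p then \<sigma> k else \<tau> (k - Suc p) + Suc a)"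

abbreviation std_join :: "nat \<Rightarrow> nat \<Rightarrow> (nat \<Rightarrow> nat, nat \<Rightarrow> nat) join_simplex sset" where
  "std_join a b \<equiv> std_simplex a \<star> std_simplex b"

lemma std_join_cases:
  assumes "s \<in> simp_set (std_join a b) m"
  obtains (left) \<sigma> where "s = JoinLeft \<sigma>" "\<sigma> \<in> simplex_mor m a"
  | (right) \<tau> where "s = JoinRight \<tau>" "\<tau> \<in> simplex_mor m b"
  | (both) p \<sigma> \<tau> where "s = JoinBoth p \<sigma> \<tau>" "p < m" "\<sigma> \<in> simplex_mor p a"
      "\<tau> \<in> simplex_mor (m - Suc p) b"
  using assms by (auto simp: join_def std_simplex_def)

lemma in_std_join:
  "JoinLeft \<sigma> \<in> simp_set (std_join a b) m \<longleftrightarrow> \<sigma> \<in> simplex_mor m a"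
  "JoinRight \<tau> \<in> simp_set (std_join a b) m \<longleftrightarrow> \<tau> \<in> simplex_mor m b"
  "JoinBoth p \<sigma> \<tau> \<in> simp_set (std_join a b) m \<longleftrightarrow>
    p < m \<and> \<sigma> \<in> simplex_mor p a \<and> \<tau> \<in> simplex_mor (m - Suc p) b"
  by (auto simp: join_def std_simplex_def)

lemma join_vertices_simplex_mor:
  assumes "s \<in> simp_set (std_join a b) m"
  shows "join_vertices a m s \<in> simplex_mor m (Suc (a + b))"
  using assms
proof (cases rule: std_join_cases)
  case (left \<sigma>)
  then show ?thesis
    by (intro simplex_morI)
      (auto simp: simplex_mor_mono simplex_mor_undefined intro: order_trans[OF simplex_mor_le])
next
  case (right \<tau>)
  then show ?thesis by (intro simplex_morI) (auto simp: simplex_mor_mono simplex_mor_le)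
next
  case (both p \<sigma> \<tau>)
  show ?thesis
  proof (rule simplex_morI)
    fix k assume "k \<le> m"
    then show "join_vertices a m s k \<le> Suc (a + b)"
      using both simplex_mor_le[OF both(3), of k] simplex_mor_le[OF both(4), of "k - Suc p"] by auto
  next
    fix k l assume "k \<le> l" "l \<le> m"
    then show "join_vertices a m s k \<le> join_vertices a m s l"
      using both simplex_mor_le[OF both(3), of k] simplex_mor_mono[OF both(3), of k l]
        simplex_mor_mono[OF both(4), of "k - Suc p" "l - Suc p"] by auto
  qed (simp add: both)
qed

lemma initial_segment_card:
  fixes S :: "nat set"
  assumes "finite S" "\<And>k l. l \<in> S \<Longrightarrow> k \<le> l \<Longrightarrow> k \<in> S"
  shows "S = {..<card S}"
proof -
  obtain c where c: "c \<notin> S" using assms(1) ex_new_if_finite infinite_UNIV_nat by blast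
  define n where "n = (LEAST k. k \<notin> S)"
  have "n \<notin> S" unfolding n_def by (rule LeastI) (rule c)
  moreover have "k \<in> S" if "k < n" for k using not_less_Least that unfolding n_def by blast
  ultimately have "S = {..<n}" using assms(2) by (metis lessThan_iff not_less subsetI subset_antisym)
  then show ?thesis by simp
qed

text \<open>Turns the cardinality by which \<open>join_act\<close> splits \<open>[m]\<close> into a
  comparison of indices.\<close>

lemma simplex_mor_initial_segment:
  assumes "\<theta> \<in> simplex_mor m n" "k \<le> m"
  shows "\<theta> k \<le> p \<longleftrightarrow> k < card {k \<in> {..m}. \<theta> k \<le> p}"
proof -
  have "{k \<in> {..m}. \<theta> k \<le> p} = {..<card {k \<in> {..m}. \<theta> k \<le> p}}"
    by (rule initial_segment_card) (auto intro: order_trans[OF simplex_mor_mono[OF assms(1)]])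
  then show ?thesis using assms(2) by blast
qed

text \<open>Naturality of the identification with \<open>\<Delta>[a + b + 1]\<close>: the three
  outcomes of \<open>join_act\<close> record whether the values of \<open>\<theta>\<close> all lie
  on the left, all lie on the right, or meet both sides.\<close>

lemma std_join_act:
  assumes s: "s \<in> simp_set (std_join a b) n" and \<theta>: "\<theta> \<in> simplex_mor m n"
  shows "act (std_join a b) m n \<theta> s \<in> simp_set (std_join a b) m" (is ?in)
    and "join_vertices a m (act (std_join a b) m n \<theta> s) = compose {..m} (join_vertices a n s) \<theta>"
      (is ?eq)
proof -
  have "?in \<and> ?eq"
    using s
  proof (cases rule: std_join_cases)
    case (left \<sigma>)
    then show ?thesis
      using simplex_mor_compose[OF \<theta>] by (simp add: in_std_join) (simp add: join_def std_simplex_def in_std_join)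
  next
    case (right \<tau>)
    then have "act (std_join a b) m n \<theta> s = JoinRight (compose {..m} \<tau> \<theta>)"
      by (simp add: join_def std_simplex_def)
    then show ?thesis
      using right simplex_mor_compose[OF \<theta> right(2)] simplex_mor_le[OF \<theta>]
      by (auto simp: in_std_join compose_def fun_eq_iff)
  next
    case (both p \<sigma> \<tau>)
    define c where "c = card {k \<in> {..m}. \<theta> k \<le> p}"
    have c: "\<theta> k \<le> p \<longleftrightarrow> k < c" if "k \<le> m" for k
      using simplex_mor_initial_segment[OF \<theta> that] by (simp add: c_def)
    have "c \<le> card {..m}" unfolding c_def by (rule card_mono) auto
    then have c_le: "c \<le> Suc m" by simp
    have act: "act (std_join a b) m n \<theta> (JoinBoth p \<sigma> \<tau>) =
      (if c = Suc m then JoinLeft (compose {..m} \<sigma> \<theta>)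
       else if c = 0 then JoinRight (compose {..m} \<tau> (\<lambda>k\<in>{..m}. \<theta> k - Suc p))
       else JoinBoth (c - 1) (compose {..c - 1} \<sigma> (restrict \<theta> {..c - 1}))
         (compose {..m - c} \<tau> (\<lambda>k\<in>{..m - c}. \<theta> (c + k) - Suc p)))"
      unfolding join_def std_simplex_def
      by (simp only: sset.select_convs join_act.simps Let_def c_def)
    consider "c = Suc m" | "c = 0" | "0 < c" "c \<le> m" using c_le by linarith
    then show ?thesis
    proof cases
      case 1
      then have "\<theta> \<in> simplex_mor m p"
        using c by (intro simplex_morI) (auto simp: simplex_mor_mono[OF \<theta>] simplex_mor_undefined[OF \<theta>])
      then have "compose {..m} \<sigma> \<theta> \<in> simplex_mor m a" by (rule simplex_mor_compose[OF _ both(3)])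
      then show ?thesis
        using 1 c simplex_mor_le[OF \<theta>] by (auto simp: act in_std_join both(1) compose_def fun_eq_iff)
    next
      case 2
      then have "(\<lambda>k\<in>{..m}. \<theta> k - Suc p) \<in> simplex_mor m (n - Suc p)"
        by (intro simplex_morI) (auto simp: simplex_mor_le[OF \<theta>] simplex_mor_mono[OF \<theta>] diff_le_mono)
      then have "compose {..m} \<tau> (\<lambda>k\<in>{..m}. \<theta> k - Suc p) \<in> simplex_mor m b"
        by (rule simplex_mor_compose[OF _ both(4)])
      then show ?thesis
        using 2 c simplex_mor_le[OF \<theta>] by (auto simp: act in_std_join both(1) compose_def fun_eq_iff)
    next
      case 3
      have "restrict \<theta> {..c - 1} \<in> simplex_mor (c - 1) p"
        using 3 c by (intro simplex_morI) (auto simp: simplex_mor_mono[OF \<theta>])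
      then have "compose {..c - 1} \<sigma> (restrict \<theta> {..c - 1}) \<in> simplex_mor (c - 1) a"
        by (rule simplex_mor_compose[OF _ both(3)])
      moreover have "(\<lambda>k\<in>{..m - c}. \<theta> (c + k) - Suc p) \<in> simplex_mor (m - c) (n - Suc p)"
        using 3 by (intro simplex_morI)
          (auto simp: simplex_mor_le[OF \<theta>] intro!: simplex_mor_mono[OF \<theta>] diff_le_mono)
      then have "compose {..m - c} \<tau> (\<lambda>k\<in>{..m - c}. \<theta> (c + k) - Suc p) \<in> simplex_mor (m - c) b"
        by (rule simplex_mor_compose[OF _ both(4)])
      ultimately have ?in using 3 by (simp add: act both(1) in_std_join)
      moreover have ?eq
        using 3 c simplex_mor_le[OF \<theta>] by (auto simp: act both(1) compose_def fun_eq_iff)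
      ultimately show ?thesis by blast
    qed
  qed
  then show ?in ?eq by auto
qed

text \<open>The simplex corresponding to the identity of \<open>[a + b + 1]\<close>, which plays the
  role of the universal element.\<close>

definition join_top :: "nat \<Rightarrow> nat \<Rightarrow> (nat \<Rightarrow> nat, nat \<Rightarrow> nat) join_simplex" where
  "join_top a b = JoinBoth a (restrict id {..a}) (restrict id {..b})"

lemma join_top_in: "join_top a b \<in> simp_set (std_join a b) (Suc (a + b))"
  by (simp add: join_top_def in_std_join simplex_mor_id)

lemma join_vertices_top: "join_vertices a (Suc (a + b)) (join_top a b) = restrict id {..Suc (a + b)}"
  by (auto simp: join_top_def fun_eq_iff)

text \<open>Every simplex of the join is obtained from the top one through its own vertex map, so a
  map out of the join is determined by a single value.\<close>

lemma act_join_top: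
  assumes "s \<in> simp_set (std_join a b) m"
  shows "act (std_join a b) m (Suc (a + b)) (join_vertices a m s) (join_top a b) = s"
  using assms
proof (cases rule: std_join_cases)
  case (left \<sigma>)
  have "{k. k \<le> m \<and> \<sigma> k \<le> a} = {..m}" using simplex_mor_le[OF left(2)] by auto
  then show ?thesis
    using left by (simp add: join_def join_top_def std_simplex_def compose_restrict_id)
next
  case (right \<tau>)
  have "compose {..m} (restrict id {..b}) (\<lambda>k\<in>{..m}. \<tau> k) = \<tau>"
    using compose_restrict_id[OF right(2)] by (simp add: compose_def cong: restrict_cong)
  moreover have "{k. k \<le> m \<and> join_vertices a m s k \<le> a} = {}" using right by auto
  ultimately show ?thesis
    using right by (simp add: join_def join_top_def std_simplex_def cong: restrict_cong)
next
  case (both p \<sigma> \<tau>)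
  let ?v = "join_vertices a m s"
  have "{k. k \<le> m \<and> ?v k \<le> a} = {..p}"
    using both simplex_mor_le[OF both(3)] by (auto split: if_splits)
  then have c: "card {k \<in> {..m}. ?v k \<le> a} = Suc p" by simp
  have "restrict ?v {..p} = \<sigma>"
    using both simplex_mor_undefined[OF both(3)] by (auto simp: fun_eq_iff)
  moreover have "(\<lambda>k\<in>{..m - Suc p}. ?v (Suc p + k) - Suc a) = \<tau>"
    using both simplex_mor_undefined[OF both(4)] by (auto simp: fun_eq_iff)
  ultimately show ?thesis
    using both(2) c compose_restrict_id[OF both(3)] compose_restrict_id[OF both(4)]
    by (simp add: join_def join_top_def std_simplex_def both(1) Let_def del: join_vertices.simps)
qed


section \<open>Path spaces as decalages\<close>

text \<open>By the Yoneda lemma, the map \<open>\<Delta>[a] \<star> \<Delta>[b] \<rightarrow> X\<close> classifying \<open>x \<in> X\<^sub>a\<^sub>+\<^sub>b\<^sub>+\<^sub>1\<close>.\<close>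

definition join_classify :: "'a sset \<Rightarrow> nat \<Rightarrow> nat \<Rightarrow> 'a \<Rightarrow> nat \<Rightarrow> (nat \<Rightarrow> nat, nat \<Rightarrow> nat) join_simplex \<Rightarrow> 'a" where
  "join_classify X a b x m =
     (\<lambda>s\<in>simp_set (std_join a b) m. act X m (Suc (a + b)) (join_vertices a m s) x)"

lemma join_classify_in_hom:
  assumes X: "simplicial_set X" and x: "x \<in> simp_set X (Suc (a + b))"
  shows "join_classify X a b x \<in> sset_hom (std_join a b) X"
  unfolding sset_hom_def
proof (intro CollectI conjI allI ballI)
  fix m
  show "join_classify X a b x m \<in> simp_set (std_join a b) m \<rightarrow>\<^sub>E simp_set X m"
    using simplicial_act_in[OF X join_vertices_simplex_mor x] by (auto simp: join_classify_def)
next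
  fix m n \<theta> s assume \<theta>: "\<theta> \<in> simplex_mor m n" and s: "s \<in> simp_set (std_join a b) n"
  show "join_classify X a b x m (act (std_join a b) m n \<theta> s) =
      act X m n \<theta> (join_classify X a b x n s)"
    using simplicial_act_compose[OF X \<theta> join_vertices_simplex_mor[OF s] x] std_join_act[OF s \<theta>] s
    by (simp add: join_classify_def)
qed

lemma bij_betw_join_classify:
  assumes X: "simplicial_set X"
  shows "bij_betw (join_classify X a b) (simp_set X (Suc (a + b))) (sset_hom (std_join a b) X)"
proof (rule bij_betw_byWitness[where f' = "\<lambda>h. h (Suc (a + b)) (join_top a b)"])
  show "\<forall>x\<in>simp_set X (Suc (a + b)). join_classify X a b x (Suc (a + b)) (join_top a b) = x"
    using X by (simp add: join_classify_def join_top_in join_vertices_top simplicial_act_id)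
  show "\<forall>h\<in>sset_hom (std_join a b) X.
      join_classify X a b (h (Suc (a + b)) (join_top a b)) = h"
  proof (intro ballI ext)
    fix h m s assume h: "h \<in> sset_hom (std_join a b) X"
    show "join_classify X a b (h (Suc (a + b)) (join_top a b)) m s = h m s"
    proof (cases "s \<in> simp_set (std_join a b) m")
      case True
      then have "h m (act (std_join a b) m (Suc (a + b)) (join_vertices a m s) (join_top a b)) =
          act X m (Suc (a + b)) (join_vertices a m s) (h (Suc (a + b)) (join_top a b))"
        using h join_top_in join_vertices_simplex_mor[OF True] by (simp add: sset_hom_def)
      then show ?thesis using True act_join_top[OF True] by (simp add: join_classify_def)
    next
      \<comment> \<open>Outside the join both sides are \<open>undefined\<close>; equality of maps
        as functions depends on this.\<close>
      case False
      moreover have "h m \<in> extensional (simp_set (std_join a b) m)"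
        using h by (auto simp: sset_hom_def PiE_def)
      ultimately show ?thesis by (simp add: join_classify_def extensional_def)
    qed
  qed
  show "join_classify X a b ` simp_set X (Suc (a + b)) \<subseteq> sset_hom (std_join a b) X"
    using join_classify_in_hom[OF X] by blast
  show "(\<lambda>h. h (Suc (a + b)) (join_top a b)) ` sset_hom (std_join a b) X \<subseteq> simp_set X (Suc (a + b))"
    using join_top_in by (fastforce simp: sset_hom_def)
qed

text \<open>The operator \<open>\<theta> \<star> \<phi> : [a + b + 1] \<rightarrow> [a' + b' + 1]\<close>, for \<open>\<theta> : [a] \<rightarrow> [a']\<close> and \<open>\<phi> : [b] \<rightarrow> [b']\<close>.\<close>

definition join_mor :: "nat \<Rightarrow> nat \<Rightarrow> nat \<Rightarrow> (nat \<Rightarrow> nat) \<Rightarrow> (nat \<Rightarrow> nat) \<Rightarrow> nat \<Rightarrow> nat" where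
  "join_mor a b a' \<theta> \<phi> = join_vertices a' (Suc (a + b)) (JoinBoth a \<theta> \<phi>)"

lemma join_mor_simplex_mor:
  assumes "\<theta> \<in> simplex_mor a a'" "\<phi> \<in> simplex_mor b b'"
  shows "join_mor a b a' \<theta> \<phi> \<in> simplex_mor (Suc (a + b)) (Suc (a' + b'))"
  using assms unfolding join_mor_def by (intro join_vertices_simplex_mor) (simp add: in_std_join)

lemma join_mor_id: "join_mor a b a (restrict id {..a}) (restrict id {..b}) = restrict id {..Suc (a + b)}"
  using join_vertices_top by (simp add: join_mor_def join_top_def)

lemma join_mor_compose:
  assumes "\<theta> \<in> simplex_mor a a'" "\<phi> \<in> simplex_mor b b'"
  shows "join_mor a b a'' (compose {..a} \<theta>' \<theta>) (compose {..b} \<phi>' \<phi>) =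
    compose {..Suc (a + b)} (join_mor a' b' a'' \<theta>' \<phi>') (join_mor a b a' \<theta> \<phi>)"
proof
  fix k
  show "join_mor a b a'' (compose {..a} \<theta>' \<theta>) (compose {..b} \<phi>' \<phi>) k =
    compose {..Suc (a + b)} (join_mor a' b' a'' \<theta>' \<phi>') (join_mor a b a' \<theta> \<phi>) k"
    using simplex_mor_le[OF assms(1), of k] simplex_mor_le[OF assms(2), of "k - Suc a"]
    by (auto simp: join_mor_def compose_def)
qed

text \<open>On vertices a join of maps is composition with \<open>join_mor\<close>. This translates
  the operators of a path space, given by precomposition, into operators of X.\<close>

lemma join_vertices_join_map:
  assumes s: "s \<in> simp_set (std_join a b) m"
    and \<theta>: "\<theta> \<in> simplex_mor a a'" and \<phi>: "\<phi> \<in> simplex_mor b b'"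
  defines "t \<equiv> join_map (std_simplex a) (std_simplex b) (std_map a \<theta>) (std_map b \<phi>) m s"
  shows "t \<in> simp_set (std_join a' b') m"
    and "join_vertices a' m t = compose {..m} (join_mor a b a' \<theta> \<phi>) (join_vertices a m s)"
proof -
  have "t \<in> simp_set (std_join a' b') m \<and>
      join_vertices a' m t = compose {..m} (join_mor a b a' \<theta> \<phi>) (join_vertices a m s)"
    using s
  proof (cases rule: std_join_cases)
    case (left \<sigma>)
    then have "t = JoinLeft (compose {..m} \<theta> \<sigma>)"
      using s by (simp add: t_def join_map_def std_map_def)
    then show ?thesis
      using left simplex_mor_compose[OF left(2) \<theta>] simplex_mor_le[OF left(2)]
      by (auto simp: in_std_join join_mor_def compose_def fun_eq_iff intro: le_SucI trans_le_add1)
  next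
    case (right \<tau>)
    then have "t = JoinRight (compose {..m} \<phi> \<tau>)"
      using s by (simp add: t_def join_map_def std_map_def)
    then show ?thesis
      using right simplex_mor_compose[OF right(2) \<phi>] simplex_mor_le[OF right(2)]
      by (auto simp: in_std_join join_mor_def compose_def fun_eq_iff)
  next
    case (both p \<sigma> \<tau>)
    then have t: "t = JoinBoth p (compose {..p} \<theta> \<sigma>) (compose {..m - Suc p} \<phi> \<tau>)"
      using s by (simp add: t_def join_map_def std_map_def)
    have "join_vertices a' m t k = compose {..m} (join_mor a b a' \<theta> \<phi>) (join_vertices a m s) k" for k
      using both simplex_mor_le[OF both(3), of k] simplex_mor_le[OF both(4), of "k - Suc p"]
      by (auto simp: t join_mor_def compose_def)
    then show ?thesis
      using both simplex_mor_compose[OF both(3) \<theta>] simplex_mor_compose[OF both(4) \<phi>]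
      by (simp add: t in_std_join ext del: join_vertices.simps)
  qed
  then show "t \<in> simp_set (std_join a' b') m"
    "join_vertices a' m t = compose {..m} (join_mor a b a' \<theta> \<phi>) (join_vertices a m s)" by auto
qed

lemma join_classify_natural:
  assumes X: "simplicial_set X" and x: "x \<in> simp_set X (Suc (a' + b'))"
    and \<theta>: "\<theta> \<in> simplex_mor a a'" and \<phi>: "\<phi> \<in> simplex_mor b b'"
  shows "sset_comp (std_join a b) (join_classify X a' b' x)
      (join_map (std_simplex a) (std_simplex b) (std_map a \<theta>) (std_map b \<phi>)) =
    join_classify X a b (act X (Suc (a + b)) (Suc (a' + b')) (join_mor a b a' \<theta> \<phi>) x)"
proof (intro ext)
  fix m s
  show "sset_comp (std_join a b) (join_classify X a' b' x)
      (join_map (std_simplex a) (std_simplex b) (std_map a \<theta>) (std_map b \<phi>)) m s =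
    join_classify X a b (act X (Suc (a + b)) (Suc (a' + b')) (join_mor a b a' \<theta> \<phi>) x) m s"
    using join_vertices_join_map[OF _ \<theta> \<phi>, of s m]
      simplicial_act_compose[OF X join_vertices_simplex_mor[of s a b m] join_mor_simplex_mor[OF \<theta> \<phi>] x]
    by (simp add: sset_comp_def compose_def join_classify_def)
qed

text \<open>Brings the identity factor in the path space operators into the form to which
  \<open>join_classify_natural\<close> applies.\<close>

lemma sset_id_std_simplex: "sset_id (std_simplex n) = std_map n (restrict id {..n})"
  by (auto simp: sset_id_def std_map_def std_simplex_def fun_eq_iff compose_restrict_id)

text \<open>The decalage at the initial vertex: \<open>\<theta>\<close> acts through the operator
  that fixes 0 and is \<open>\<theta>\<close> shifted by one elsewhere.\<close>

definition left_dec :: "'a sset \<Rightarrow> 'a sset" where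
  "left_dec X = \<lparr>simp_set = (\<lambda>n. simp_set X (Suc n)),
     act = (\<lambda>m n \<theta>. act X (Suc m) (Suc n) (join_mor 0 m 0 (restrict id {..0}) \<theta>))\<rparr>"

text \<open>The decalage at the final vertex: \<open>\<theta>\<close> acts through its extension
  sending \<open>Suc m\<close> to \<open>Suc n\<close>.\<close>

definition right_dec :: "'a sset \<Rightarrow> 'a sset" where
  "right_dec X = \<lparr>simp_set = (\<lambda>n. simp_set X (Suc n)),
     act = (\<lambda>m n \<theta>. act X (Suc m) (Suc n) (join_mor m 0 n \<theta> (restrict id {..0})))\<rparr>"

lemma simplicial_left_dec:
  assumes X: "simplicial_set X"
  shows "simplicial_set (left_dec X)"
proof -
  let ?i = "restrict id {..0::nat}"
  have mor: "join_mor 0 m 0 ?i \<theta> \<in> simplex_mor (Suc m) (Suc n)" if "\<theta> \<in> simplex_mor m n" for m n \<theta>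
    using join_mor_simplex_mor[OF simplex_mor_id that, of 0] by simp
  have comp: "join_mor 0 k 0 ?i (compose {..k} \<theta> \<phi>) =
      compose {..Suc k} (join_mor 0 m 0 ?i \<theta>) (join_mor 0 k 0 ?i \<phi>)"
    if "\<phi> \<in> simplex_mor k m" for k m \<theta> \<phi>
    using join_mor_compose[OF simplex_mor_id that, of 0 0 ?i \<theta>] compose_restrict_id[OF simplex_mor_id, of 0]
    by simp
  have id: "join_mor 0 n 0 ?i (restrict id {..n}) = restrict id {..Suc n}" for n
    using join_mor_id[of 0 n] by simp
  show ?thesis
    unfolding simplicial_set_def left_dec_def
    by (simp add: Pi_iff comp id simplicial_act_in[OF X mor] simplicial_act_id[OF X]
        simplicial_act_compose[OF X mor mor] del: atMost_0)
qed

lemma simplicial_right_dec: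
  assumes X: "simplicial_set X"
  shows "simplicial_set (right_dec X)"
proof -
  let ?i = "restrict id {..0::nat}"
  have mor: "join_mor m 0 n \<theta> ?i \<in> simplex_mor (Suc m) (Suc n)" if "\<theta> \<in> simplex_mor m n" for m n \<theta>
    using join_mor_simplex_mor[OF that simplex_mor_id, of 0] by simp
  have comp: "join_mor k 0 n (compose {..k} \<theta> \<phi>) ?i =
      compose {..Suc k} (join_mor m 0 n \<theta> ?i) (join_mor k 0 m \<phi> ?i)"
    if "\<phi> \<in> simplex_mor k m" for k m n \<theta> \<phi>
    using join_mor_compose[OF that simplex_mor_id, of 0 n \<theta> ?i] compose_restrict_id[OF simplex_mor_id, of 0]
    by simp
  have id: "join_mor n 0 n (restrict id {..n}) ?i = restrict id {..Suc n}" for n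
    using join_mor_id[of n 0] by simp
  show ?thesis
    unfolding simplicial_set_def right_dec_def
    by (simp add: Pi_iff comp id simplicial_act_in[OF X mor] simplicial_act_id[OF X]
        simplicial_act_compose[OF X mor mor] del: atMost_0)
qed

section \<open>Invariance of fillers under isomorphism\<close>

definition sset_iso :: "(nat \<Rightarrow> 'a \<Rightarrow> 'b) \<Rightarrow> 'a sset \<Rightarrow> 'b sset \<Rightarrow> bool" where
  "sset_iso f X Y \<longleftrightarrow> (\<forall>n. bij_betw (f n) (simp_set X n) (simp_set Y n)) \<and>
     (\<forall>m n. \<forall>\<theta>\<in>simplex_mor m n. \<forall>x\<in>simp_set X n. f m (act X m n \<theta> x) = act Y m n \<theta> (f n x))"

lemma sset_iso_left_path_space:
  "simplicial_set X \<Longrightarrow> sset_iso (join_classify X 0) (left_dec X) (left_path_space X)"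
  using bij_betw_join_classify[of X 0] join_classify_natural[of X _ 0 _ _ 0, OF _ _ simplex_mor_id]
  by (simp add: sset_iso_def left_dec_def left_path_space_def sset_id_std_simplex)

lemma sset_iso_right_path_space:
  "simplicial_set X \<Longrightarrow> sset_iso (\<lambda>n. join_classify X n 0) (right_dec X) (right_path_space X)"
  using bij_betw_join_classify[of X _ 0] join_classify_natural[of X _ _ 0 _ _ _ 0, OF _ _ _ simplex_mor_id]
  by (simp add: sset_iso_def right_dec_def right_path_space_def sset_id_std_simplex)

text \<open>This yields the simplicial identities of the path spaces, by transport from the
  decalages.\<close>

lemma sset_iso_simplicial:
  assumes f: "sset_iso f X Y" and X: "simplicial_set X"
  shows "simplicial_set Y"
proof -
  have "f n ` simp_set X n = simp_set Y n" for n
    using f by (simp add: sset_iso_def bij_betw_def)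
  then have pre: "\<exists>x\<in>simp_set X n. y = f n x" if "y \<in> simp_set Y n" for n y
    using that by blast
  have im: "f n x \<in> simp_set Y n" if "x \<in> simp_set X n" for n x
    using f that by (auto simp: sset_iso_def bij_betw_def)
  have nat: "act Y m n \<theta> (f n x) = f m (act X m n \<theta> x)"
    if "\<theta> \<in> simplex_mor m n" "x \<in> simp_set X n" for m n \<theta> x
    using f that by (simp add: sset_iso_def)
  show ?thesis
    unfolding simplicial_set_def
  proof (intro conjI allI ballI Pi_I)
    fix m n \<theta> y assume "\<theta> \<in> simplex_mor m n" "y \<in> simp_set Y n"
    then show "act Y m n \<theta> y \<in> simp_set Y m"
      using pre[of y n] by (auto simp: nat im simplicial_act_in[OF X])
  next
    fix n y assume "y \<in> simp_set Y n"
    then show "act Y n n (restrict id {..n}) y = y"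
      using pre[of y n] by (auto simp: nat simplex_mor_id simplicial_act_id[OF X])
  next
    fix k m n \<phi> \<theta> y assume "\<phi> \<in> simplex_mor k m" "\<theta> \<in> simplex_mor m n" "y \<in> simp_set Y n"
    then show "act Y k n (compose {..k} \<theta> \<phi>) y = act Y k m \<phi> (act Y m n \<theta> y)"
      using pre[of y n]
      by (auto simp: nat simplex_mor_compose simplicial_act_in[OF X] simplicial_act_compose[OF X])
  qed
qed

lemma sset_iso_sym:
  assumes f: "sset_iso f X Y" and X: "simplicial_set X"
  shows "sset_iso (\<lambda>n. inv_into (simp_set X n) (f n)) Y X"
  unfolding sset_iso_def
proof (intro conjI allI ballI)
  fix n show "bij_betw (inv_into (simp_set X n) (f n)) (simp_set Y n) (simp_set X n)"
    using f by (simp add: sset_iso_def bij_betw_inv_into)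
next
  fix m n \<theta> y assume \<theta>: "\<theta> \<in> simplex_mor m n" and y: "y \<in> simp_set Y n"
  have "f n ` simp_set X n = simp_set Y n" using f by (simp add: sset_iso_def bij_betw_def)
  then obtain x where x: "x \<in> simp_set X n" "y = f n x" using y by blast
  have inv: "inv_into (simp_set X k) (f k) (f k z) = z" if "z \<in> simp_set X k" for k z
    using f that by (auto simp: sset_iso_def bij_betw_def)
  have "act Y m n \<theta> y = f m (act X m n \<theta> x)" using f \<theta> x by (simp add: sset_iso_def)
  then show "inv_into (simp_set X m) (f m) (act Y m n \<theta> y) =
      act X m n \<theta> (inv_into (simp_set X n) (f n) y)"
    using inv[OF simplicial_act_in[OF X \<theta> x(1)]] inv[OF x(1)] x(2) by simp
qed

lemma sset_iso_fillable:
  assumes f: "sset_iso f X Y" and X: "simplicial_set X" and fill: "fillable X n L"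
  shows "fillable Y n L"
  unfolding fillable_def
proof (intro allI impI)
  fix y
  assume y: "(\<forall>l\<in>L. y l \<in> simp_set Y (Suc n)) \<and>
    (\<forall>a\<in>L. \<forall>b\<in>L. a < b \<longrightarrow> face_op Y n a (y b) = face_op Y n (b - 1) (y a))"
  have nat: "face_op Y n l (f (Suc n) x) = f n (face_op X n l x)" if "x \<in> simp_set X (Suc n)" for n l x
    using f that coface_simplex_mor by (simp add: sset_iso_def face_op_def)
  have inj: "inj_on (f n) (simp_set X n)" and surj: "f n ` simp_set X n = simp_set Y n" for n
    using f by (auto simp: sset_iso_def bij_betw_def)
  define x where "x l = inv_into (simp_set X (Suc n)) (f (Suc n)) (y l)" for l
  have x: "x l \<in> simp_set X (Suc n)" "f (Suc n) (x l) = y l" if "l \<in> L" for l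
    using y that surj[of "Suc n"] by (auto simp: x_def inv_into_into f_inv_into_f)
  have "face_op X n a (x b) = face_op X n (b - 1) (x a)" if "a \<in> L" "b \<in> L" "a < b" for a b
  \<comment> \<open>Compatibility of the pulled-back family is tested in \<open>Y\<close>, which
    suffices because \<open>f n\<close> is injective.\<close>
  proof (rule inj_onD[OF inj[of n]])
    show "f n (face_op X n a (x b)) = f n (face_op X n (b - 1) (x a))"
      using nat[OF x(1)[OF that(1)]] nat[OF x(1)[OF that(2)]] x(2) y that by metis
  qed (auto simp: face_op_def intro!: simplicial_act_in[OF X coface_simplex_mor] x that)
  with x(1) have "\<exists>z\<in>simp_set X (Suc (Suc n)). \<forall>l\<in>L. face_op X (Suc n) l z = x l"
    by (intro fill[unfolded fillable_def, rule_format]) blast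
  then obtain z where z: "z \<in> simp_set X (Suc (Suc n))" "\<forall>l\<in>L. face_op X (Suc n) l z = x l"
    by blast
  show "\<exists>z\<in>simp_set Y (Suc (Suc n)). \<forall>l\<in>L. face_op Y (Suc n) l z = y l"
    using z x(2) nat[OF z(1)] surj[of "Suc (Suc n)"] by (intro bexI[of _ "f (Suc (Suc n)) z"]) auto
qed

lemma sset_iso_fillable_iff:
  assumes "sset_iso f X Y" "simplicial_set X"
  shows "fillable Y n L \<longleftrightarrow> fillable X n L"
  using sset_iso_fillable[OF assms]
    sset_iso_fillable[OF sset_iso_sym[OF assms] sset_iso_simplicial[OF assms]] by blast

section \<open>Faces and fillers in the decalages\<close>

lemma face_op_left_dec: "face_op (left_dec X) n l = face_op X (Suc n) (Suc l)"
proof -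
  have "join_mor 0 n 0 (restrict id {..0}) (coface n l) = coface (Suc n) (Suc l)"
    by (auto simp: join_mor_def coface_def fun_eq_iff)
  then show ?thesis by (simp add: face_op_def left_dec_def)
qed

text \<open>The bound on \<open>l\<close> matters: the extended operator always attains the added
  vertex \<open>n + 2\<close>, whereas the coface at \<open>l = n + 2\<close> omits it.\<close>

lemma face_op_right_dec:
  assumes "l \<le> Suc n"
  shows "face_op (right_dec X) n l = face_op X (Suc n) l"
proof -
  have "join_mor n 0 (Suc n) (coface n l) (restrict id {..0}) = coface (Suc n) l"
    using assms by (auto simp: join_mor_def coface_def fun_eq_iff)
  then show ?thesis by (simp add: face_op_def right_dec_def)
qed

lemma fillable_left_dec: "fillable (left_dec X) n L \<longleftrightarrow> fillable X (Suc n) (Suc ` L)"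
proof
  assume fill: "fillable (left_dec X) n L"
  show "fillable X (Suc n) (Suc ` L)"
    unfolding fillable_def
  proof (intro allI impI)
    fix x
    assume x: "(\<forall>l\<in>Suc ` L. x l \<in> simp_set X (Suc (Suc n))) \<and> (\<forall>a\<in>Suc ` L. \<forall>b\<in>Suc ` L.
      a < b \<longrightarrow> face_op X (Suc n) a (x b) = face_op X (Suc n) (b - 1) (x a))"
    have "\<exists>y\<in>simp_set (left_dec X) (Suc (Suc n)). \<forall>l\<in>L. face_op (left_dec X) (Suc n) l y = x (Suc l)"
    proof (intro fill[unfolded fillable_def, rule_format] conjI ballI impI)
      fix a b assume "a \<in> L" "b \<in> L" "a < b"
      then show "face_op (left_dec X) n a (x (Suc b)) = face_op (left_dec X) n (b - 1) (x (Suc a))"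
        \<comment> \<open>From \<open>a < b\<close> it follows that \<open>b\<close> is positive, so
          \<open>Suc (b - 1)\<close> equals \<open>Suc b - 1\<close>.\<close>
        using x by (cases b) (simp_all add: face_op_left_dec)
    qed (use x in \<open>simp add: left_dec_def\<close>)
    then show "\<exists>y\<in>simp_set X (Suc (Suc (Suc n))). \<forall>l\<in>Suc ` L. face_op X (Suc (Suc n)) l y = x l"
      by (simp add: face_op_left_dec) (simp add: left_dec_def)
  qed
next
  assume fill: "fillable X (Suc n) (Suc ` L)"
  show "fillable (left_dec X) n L"
    unfolding fillable_def
  proof (intro allI impI)
    fix x
    assume x: "(\<forall>l\<in>L. x l \<in> simp_set (left_dec X) (Suc n)) \<and> (\<forall>a\<in>L. \<forall>b\<in>L.
      a < b \<longrightarrow> face_op (left_dec X) n a (x b) = face_op (left_dec X) n (b - 1) (x a))"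
    have "\<exists>y\<in>simp_set X (Suc (Suc (Suc n))). \<forall>l\<in>Suc ` L. face_op X (Suc (Suc n)) l y = x (l - 1)"
    proof (intro fill[unfolded fillable_def, rule_format] conjI ballI impI)
      fix a b assume "a \<in> Suc ` L" "b \<in> Suc ` L" "a < b"
      then obtain a' b' where ab: "a = Suc a'" "b = Suc b'" "a' \<in> L" "b' \<in> L" "a' < b'" by auto
      then have "face_op (left_dec X) n a' (x b') = face_op (left_dec X) n (b' - 1) (x a')"
        using x by blast
      then show "face_op X (Suc n) a (x (b - 1)) = face_op X (Suc n) (b - 1) (x (a - 1))"
        using ab by (simp add: face_op_left_dec)
    qed (use x in \<open>auto simp: left_dec_def\<close>)
    then show "\<exists>y\<in>simp_set (left_dec X) (Suc (Suc n)). \<forall>l\<in>L. face_op (left_dec X) (Suc n) l y = x l"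
      by (simp add: face_op_left_dec) (simp add: left_dec_def)
  qed
qed

lemma fillable_right_dec:
  assumes "L \<subseteq> {..Suc (Suc n)}"
  shows "fillable (right_dec X) n L \<longleftrightarrow> fillable X (Suc n) L"
proof -
  have "face_op (right_dec X) n a = face_op X (Suc n) a"
    "face_op (right_dec X) n (b - 1) = face_op X (Suc n) (b - 1)" if "b \<in> L" "a < b" for a b
    using that assms by (auto intro!: face_op_right_dec)
  moreover have "face_op (right_dec X) (Suc n) l = face_op X (Suc (Suc n)) l" if "l \<in> L" for l
    using that assms by (auto intro: face_op_right_dec)
  moreover have "simp_set (right_dec X) m = simp_set X (Suc m)" for m by (simp add: right_dec_def)
  ultimately show ?thesis unfolding fillable_def by (simp cong: ball_cong imp_cong)
qed

section \<open>Quasi-categories and 2-Segal horns\<close>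

lemma quasi_category_iff_fillable:
  assumes "simplicial_set X"
  shows "quasi_category X \<longleftrightarrow>
    (\<forall>n i. 0 < i \<and> i < Suc (Suc n) \<longrightarrow> fillable X n ({..Suc (Suc n)} - {i}))"
proof -
  have "extends_along (horn (Suc (Suc n)) i) (std_simplex (Suc (Suc n))) X \<longleftrightarrow>
      fillable X n ({..Suc (Suc n)} - {i})" for n i
    unfolding horn_def extends_along_face_union_iff
    by (rule extendable_iff_fillable[OF assms]) auto
  \<comment> \<open>Inner horns live in dimension at least 2, so the offset in
    \<open>fillable\<close> loses none of them.\<close>
  moreover have "\<exists>n'. n = Suc (Suc n')" if "0 < i" "i < n" for i n :: nat
    using that by presburger
  ultimately show ?thesis using assms unfolding quasi_category_def by metis
qed

lemma segal_fillable_iff_fillable: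
  assumes "simplicial_set X"
  shows "segal_fillable X (Suc (Suc n)) p q \<longleftrightarrow> fillable X n ({..Suc (Suc n)} - {p, q})"
  unfolding segal_fillable_def by (rule extendable_iff_fillable[OF assms]) auto

lemma quasi_category_left_path_space_iff:
  assumes X: "simplicial_set X"
  shows "quasi_category (left_path_space X) \<longleftrightarrow> (\<forall>n q. 2 \<le> q \<and> q < n \<longrightarrow> segal_fillable X n 0 q)"
proof -
  note iso = sset_iso_left_path_space[OF X] and dec = simplicial_left_dec[OF X]
  \<comment> \<open>The shift leaves 0 outside the index set, so the inner horn at \<open>i\<close>
    becomes the 2-Segal horn at 0 and \<open>i + 1\<close>.\<close>
  have "Suc ` ({..Suc (Suc n)} - {i}) = {..Suc (Suc (Suc n))} - {0, Suc i}" for n i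
    by (auto simp: image_set_diff[OF inj_Suc] image_Suc_atMost)
  then have "fillable (left_path_space X) n ({..Suc (Suc n)} - {i}) \<longleftrightarrow>
      segal_fillable X (Suc (Suc (Suc n))) 0 (Suc i)" for n i
    unfolding sset_iso_fillable_iff[OF iso dec] fillable_left_dec segal_fillable_iff_fillable[OF X]
    by simp
  then have "quasi_category (left_path_space X) \<longleftrightarrow>
      (\<forall>n i. 0 < i \<and> i < Suc (Suc n) \<longrightarrow> segal_fillable X (Suc (Suc (Suc n))) 0 (Suc i))"
    unfolding quasi_category_iff_fillable[OF sset_iso_simplicial[OF iso dec]] by simp
  also have "\<dots> \<longleftrightarrow> (\<forall>n q. 2 \<le> q \<and> q < n \<longrightarrow> segal_fillable X n 0 q)"
  proof (intro iffI allI impI)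
    fix n q :: nat
    assume *: "\<forall>n i. 0 < i \<and> i < Suc (Suc n) \<longrightarrow> segal_fillable X (Suc (Suc (Suc n))) 0 (Suc i)"
      and q: "2 \<le> q \<and> q < n"
    have "Suc (Suc (Suc (n - 3))) = n" "Suc (q - 1) = q" "0 < q - 1 \<and> q - 1 < Suc (Suc (n - 3))"
      using q by linarith+
    then show "segal_fillable X n 0 q" using * by metis
  qed auto
  finally show ?thesis .
qed

lemma quasi_category_right_path_space_iff:
  assumes X: "simplicial_set X"
  shows "quasi_category (right_path_space X) \<longleftrightarrow>
    (\<forall>n p. 1 \<le> p \<and> p + 2 \<le> n \<longrightarrow> segal_fillable X n p n)"
proof -
  note iso = sset_iso_right_path_space[OF X] and dec = simplicial_right_dec[OF X]
  \<comment> \<open>Indices are not shifted here, but the added last vertex is not an index of the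
    horn and becomes the second missing face.\<close>
  have "{..Suc (Suc n)} - {i} = {..Suc (Suc (Suc n))} - {i, Suc (Suc (Suc n))}" for n i
    by auto
  then have "fillable (right_path_space X) n ({..Suc (Suc n)} - {i}) \<longleftrightarrow>
      segal_fillable X (Suc (Suc (Suc n))) i (Suc (Suc (Suc n)))" for n i
    using fillable_right_dec[of "{..Suc (Suc n)} - {i}" n X]
    unfolding sset_iso_fillable_iff[OF iso dec] segal_fillable_iff_fillable[OF X]
    by auto
  then have "quasi_category (right_path_space X) \<longleftrightarrow>
      (\<forall>n i. 0 < i \<and> i < Suc (Suc n) \<longrightarrow>
        segal_fillable X (Suc (Suc (Suc n))) i (Suc (Suc (Suc n))))"
    unfolding quasi_category_iff_fillable[OF sset_iso_simplicial[OF iso dec]] by simp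
  also have "\<dots> \<longleftrightarrow> (\<forall>n p. 1 \<le> p \<and> p + 2 \<le> n \<longrightarrow> segal_fillable X n p n)"
  proof (intro iffI allI impI)
    fix n p :: nat
    assume *: "\<forall>n i. 0 < i \<and> i < Suc (Suc n) \<longrightarrow>
        segal_fillable X (Suc (Suc (Suc n))) i (Suc (Suc (Suc n)))"
      and p: "1 \<le> p \<and> p + 2 \<le> n"
    have "Suc (Suc (Suc (n - 3))) = n" "0 < p \<and> p < Suc (Suc (n - 3))" using p by linarith+
    then show "segal_fillable X n p n" using * by metis
  qed auto
  finally show ?thesis .
qed

text \<open>Brokenness of a pair asks for one vertex strictly between \<open>i\<close> and
  \<open>j\<close> and one before \<open>i\<close> or after \<open>j\<close>. So the two must not be
  adjacent in the cyclic order of the vertices.\<close>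

lemma broken_pair_iff:
  assumes "i < j"
  shows "broken n {i, j} \<and> {i, j} \<subseteq> {..n} \<longleftrightarrow> i + 2 \<le> j \<and> j \<le> n \<and> (0 < i \<or> j < n)"
proof
  assume "broken n {i, j} \<and> {i, j} \<subseteq> {..n}"
  then show "i + 2 \<le> j \<and> j \<le> n \<and> (0 < i \<or> j < n)"
    using assms unfolding broken_def by auto
next
  assume ij: "i + 2 \<le> j \<and> j \<le> n \<and> (0 < i \<or> j < n)"
  have "broken n {i, j}"
  proof (cases "j < n")
    case True
    then show ?thesis unfolding broken_def
      using ij by (intro exI[of _ i] exI[of _ "Suc i"] exI[of _ j] exI[of _ n]) auto
  next
    case False
    then show ?thesis unfolding broken_def
      using ij by (intro exI[of _ 0] exI[of _ i] exI[of _ "Suc i"] exI[of _ j]) auto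
  qed
  then show "broken n {i, j} \<and> {i, j} \<subseteq> {..n}" using ij assms by auto
qed

lemma quasi_2_segal_set_iff_segal_fillable:
  assumes X: "simplicial_set X"
  shows "quasi_2_segal_set X \<longleftrightarrow>
    (\<forall>n i j. i + 2 \<le> j \<and> j \<le> n \<and> (0 < i \<or> j < n) \<longrightarrow> segal_fillable X n i j)"
proof -
  have ext: "extends_along (segal_horn n i j) (std_simplex n) X \<longleftrightarrow> segal_fillable X n i j" for n i j
    by (simp add: segal_horn_def segal_fillable_def extends_along_face_union_iff)
  \<comment> \<open>The definition admits the two vertices in either order, while the criterion
    fixes \<open>i\<close> as the smaller one.\<close>
  have sym: "segal_fillable X n i j \<longleftrightarrow> segal_fillable X n j i" for n i j
    by (simp add: segal_fillable_def insert_commute)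
  show ?thesis
  proof (intro iffI allI impI)
    fix n i j :: nat assume q: "quasi_2_segal_set X" and ij: "i + 2 \<le> j \<and> j \<le> n \<and> (0 < i \<or> j < n)"
    then have "broken n {i, j} \<and> {i, j} \<subseteq> {..n}" "i \<noteq> j" "3 \<le> n"
      using broken_pair_iff[of i j n] by auto
    then show "segal_fillable X n i j" using q unfolding quasi_2_segal_set_def ext by blast
  next
    assume *: "\<forall>n i j. i + 2 \<le> j \<and> j \<le> n \<and> (0 < i \<or> j < n) \<longrightarrow> segal_fillable X n i j"
    have "segal_fillable X n i j" if "{i, j} \<subseteq> {..n} \<and> i \<noteq> j \<and> broken n {i, j}" for n i j :: nat
    proof (cases i j rule: linorder_cases)
      case less
      then show ?thesis using * broken_pair_iff[OF less] that by blast
    next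
      case greater
      then have "segal_fillable X n j i"
        using * broken_pair_iff[OF greater] that by (metis insert_commute)
      then show ?thesis by (simp only: sym[of n i j])
    qed (use that in simp)
    then show "quasi_2_segal_set X" using X unfolding quasi_2_segal_set_def ext by blast
  qed
qed

theorem theorem4p6:
  fixes X :: "'a sset"
  assumes "simplicial_set X"
  shows "quasi_2_segal_set X \<longleftrightarrow>
    quasi_category (left_path_space X) \<and> quasi_category (right_path_space X)"
  unfolding quasi_2_segal_set_iff_segal_fillable[OF assms]
    quasi_category_left_path_space_iff[OF assms] quasi_category_right_path_space_iff[OF assms]
proof (intro iffI conjI allI impI; (elim conjE)?)
  fix n i j :: nat
  assume "\<forall>n q. 2 \<le> q \<and> q < n \<longrightarrow> segal_fillable X n 0 q"
    and "\<forall>n p. 1 \<le> p \<and> p + 2 \<le> n \<longrightarrow> segal_fillable X n p n"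
    and "i + 2 \<le> j" "j \<le> n" "0 < i \<or> j < n"
  then show "segal_fillable X n i j"
    by (blast intro!: segal_fillable_if_outer[of X i j n])
\<comment> \<open>The converse specialises the pair: \<open>i = 0\<close> gives the left path space
  and \<open>j = n\<close> the right one.\<close>
qed auto

end
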